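(* Let $X$ be a locally convex Hausdorff topological vector space over $\mathbb{K}\in\{\mathbb{R},\mathbb{C}\}$, with continuous dual $X'$. The following are equivalent: (1) $X$ is separable; (2) the locally convex Hausdorff space $(X',\sigma(X',X))$ is countably separated; (3) there is a metrizable topology on $X'$ that is coarser than $\sigma(X',X)$; (3') there is a metrizable locally convex vector space topology on $X'$ that is coarser than $\sigma(X',X)$.
   Context: $\sigma(X',X)$ is the weak topology on $X'$ induced by the pairing with $X$ (the weak* topology, i.e. pointwise convergence on $X$). A null neighborhood is a neighborhood of the origin. "Coarser" is meant in the non-strict sense. For a locally convex Hausdorff space $Y$ with continuous dual $Y'$ and $A\subseteq Y$, the polar is $A^\circ=\{y'\in Y' : \operatorname{Re}\langle y',y\rangle\le 1 \text{ for all } y\in A\}$, and for $B\subseteq Y'$, $y\in Y$, the support function is $S(B,y)=\sup_{y'\in B}\operatorname{Re}\langle y',y\rangle$ (real parts are superfluous if $\mathbb{K}=\mathbb{R}$). $Y$ is called countably separated if there is a sequence $(U_n)_{n\ge1}$ of absolutely convex, closed null neighborhoods in $Y$ with $\bigcap_{n\ge 1}\{y\in Y : S(U_n^\circ,y)=0\}=\{0\}$. In (2) this is applied to $Y=(X',\sigma(X',X))$, whose continuous dual is $X$. *)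

theory Defs
  imports "HOL-Analysis.Analysis" "HOL-Library.Function_Algebras"
begin

text \<open>
  The scalar field is either the reals or the complex numbers. This class lets both
  cases be treated uniformly, including real parts. For the reals, \<open>im_unit\<close> and \<open>im_part\<close>
  vanish. The axioms admit no further instances: see \<open>real_or_complex_cases\<close>.
\<close>

class real_or_complex = real_normed_field +
  fixes re_part :: "'a \<Rightarrow> real"
    and im_part :: "'a \<Rightarrow> real"
    and im_unit :: 'a
  assumes re_im_decomp: "z = re_part z *\<^sub>R 1 + im_part z *\<^sub>R im_unit"
    and im_unit_cases: "im_unit = 0 \<or> im_unit * im_unit = - 1"
    and norm_re_im: "(norm z)\<^sup>2 = (re_part z)\<^sup>2 + (im_part z)\<^sup>2"

instantiation real :: real_or_complex
begin
definition re_part_real :: "real \<Rightarrow> real" where "re_part_real z = z"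
definition im_part_real :: "real \<Rightarrow> real" where "im_part_real z = 0"
definition im_unit_real :: real where "im_unit_real = 0"
instance
  by standard (simp_all add: re_part_real_def im_part_real_def im_unit_real_def)
end

instantiation complex :: real_or_complex
begin
definition re_part_complex :: "complex \<Rightarrow> real" where "re_part_complex = Re"
definition im_part_complex :: "complex \<Rightarrow> real" where "im_part_complex = Im"
definition im_unit_complex :: complex where "im_unit_complex = \<i>"
instance
  by standard
    (simp_all add: re_part_complex_def im_part_complex_def im_unit_complex_def
      complex_eq_iff cmod_power2)
end

lemma real_or_complex_cases:
  obtains
    (real) \<phi> :: "'k::real_or_complex \<Rightarrow> real" where
      "bij \<phi>" "\<And>x y. \<phi> (x + y) = \<phi> x + \<phi> y" "\<And>x y. \<phi> (x * y) = \<phi> x * \<phi> y"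
      "\<And>x. norm (\<phi> x) = norm x" "\<And>x. re_part x = \<phi> x"
  | (complex) \<psi> :: "'k::real_or_complex \<Rightarrow> complex" where
      "bij \<psi>" "\<And>x y. \<psi> (x + y) = \<psi> x + \<psi> y" "\<And>x y. \<psi> (x * y) = \<psi> x * \<psi> y"
      "\<And>x. norm (\<psi> x) = norm x" "\<And>x. re_part x = Re (\<psi> x)"
proof (cases "(im_unit :: 'k) = 0")
  case True
  then have z: "z = of_real (re_part z)" for z :: 'k
    using re_im_decomp[of z] True by (simp add: of_real_def)
  have of: "re_part (of_real r :: 'k) = r" for r
    using z[of "of_real r"] by (metis of_real_eq_iff)
  have "bij (re_part :: 'k \<Rightarrow> real)"
    by (rule o_bij[of of_real]) (simp_all only: fun_eq_iff o_def id_def of z[symmetric] simp_thms)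
  moreover have "re_part (x + y) = re_part x + re_part y" for x y :: 'k
    by (metis z of of_real_add)
  moreover have "re_part (x * y) = re_part x * re_part y" for x y :: 'k
    by (metis z of of_real_mult)
  moreover have "norm (re_part x) = norm x" for x :: 'k
    by (metis z norm_of_real real_norm_def)
  ultimately show ?thesis using real by blast
next
  case False
  then have sq: "im_unit * im_unit = (- 1 :: 'k)" using im_unit_cases by blast
  define g :: "complex \<Rightarrow> 'k" where "g w = of_real (Re w) + of_real (Im w) * im_unit" for w
  define h :: "'k \<Rightarrow> complex" where "h z = Complex (re_part z) (im_part z)" for z
  have gadd: "g (v + w) = g v + g w" for v w by (simp add: g_def algebra_simps)
  have gmult: "g (v * w) = g v * g w" for v w
  proof -
    have "g v * g w = of_real (Re v) * of_real (Re w)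
        + of_real (Im v) * of_real (Im w) * (im_unit * im_unit)
        + (of_real (Re v) * of_real (Im w) + of_real (Im v) * of_real (Re w)) * im_unit"
      by (simp add: g_def algebra_simps)
    also have "\<dots> = g (v * w)"
      unfolding sq by (simp add: g_def algebra_simps)
    finally show ?thesis by simp
  qed
  have gh: "g (h z) = z" for z
    using re_im_decomp[of z] by (simp add: g_def h_def scaleR_conv_of_real)
  have "w = 0" if "g w = 0" for w
  proof (rule ccontr)
    assume "w \<noteq> 0"
    then have "g w * g (inverse w) = g 1" by (simp flip: gmult)
    moreover have "g 1 = 1" by (simp add: g_def)
    ultimately show False using that by simp
  qed
  then have inj: "v = w" if "g v = g w" for v w
    using gadd[of "v - w" w] that by (metis add_cancel_left_left diff_add_cancel eq_iff_diff_eq_0)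
  have hg: "h (g w) = w" for w using inj gh by blast
  have "bij h" by (rule o_bij[of g]) (auto simp: fun_eq_iff gh hg)
  moreover have "h (x + y) = h x + h y" for x y by (metis gadd gh hg)
  moreover have "h (x * y) = h x * h y" for x y by (metis gmult gh hg)
  moreover have "norm (h x) = norm x" for x
    using norm_re_im[of x] by (simp add: h_def cmod_def) (metis norm_ge_zero real_sqrt_unique)
  moreover have "re_part x = Re (h x)" for x by (simp add: h_def)
  ultimately show ?thesis using complex by blast
qed

text \<open>
  Spaces are carried by linear subspaces of an ambient vector space type: the carrier is
  the topspace of the topology. This allows a space and its dual to be treated alike.
\<close>

definition convex_wrt :: "('k::real_or_complex \<Rightarrow> 'a::ab_group_add \<Rightarrow> 'a) \<Rightarrow> 'a set \<Rightarrow> bool"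
  where "convex_wrt smul C \<longleftrightarrow>
    (\<forall>x\<in>C. \<forall>y\<in>C. \<forall>u\<ge>0. \<forall>v\<ge>0. u + v = 1 \<longrightarrow>
      smul (of_real u) x + smul (of_real v) y \<in> C)"

definition absolutely_convex ::
    "('k::real_or_complex \<Rightarrow> 'a::ab_group_add \<Rightarrow> 'a) \<Rightarrow> 'a set \<Rightarrow> bool"
  where "absolutely_convex smul C \<longleftrightarrow>
    (\<forall>x\<in>C. \<forall>y\<in>C. \<forall>a b. norm a + norm b \<le> 1 \<longrightarrow> smul a x + smul b y \<in> C)"

definition null_nbhd :: "'a::ab_group_add topology \<Rightarrow> 'a set \<Rightarrow> bool"
  where "null_nbhd T U \<longleftrightarrow> U \<subseteq> topspace T \<and> (\<exists>V. openin T V \<and> 0 \<in> V \<and> V \<subseteq> U)"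

definition topological_vector_space ::
    "('k::real_or_complex \<Rightarrow> 'a::ab_group_add \<Rightarrow> 'a) \<Rightarrow> 'a topology \<Rightarrow> bool"
  where "topological_vector_space smul T \<longleftrightarrow>
    vector_space smul \<and> module.subspace smul (topspace T) \<and>
    continuous_map (prod_topology T T) T (\<lambda>(x, y). x + y) \<and>
    continuous_map (prod_topology euclidean T) T (\<lambda>(c, x). smul c x)"

definition locally_convex_space ::
    "('k::real_or_complex \<Rightarrow> 'a::ab_group_add \<Rightarrow> 'a) \<Rightarrow> 'a topology \<Rightarrow> bool"
  where "locally_convex_space smul T \<longleftrightarrow>
    topological_vector_space smul T \<and>
    (\<forall>U. null_nbhd T U \<longrightarrow> (\<exists>C. null_nbhd T C \<and> convex_wrt smul C \<and> C \<subseteq> U))"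

text \<open>
  Functionals on the carrier are represented by total functions vanishing outside it, so that
  the dual is itself a linear subspace of the type of scalar-valued functions, with pointwise
  operations.
\<close>

definition dual_space ::
    "('k::real_or_complex \<Rightarrow> 'a::ab_group_add \<Rightarrow> 'a) \<Rightarrow> 'a topology \<Rightarrow> ('a \<Rightarrow> 'k) set"
  where "dual_space smul T = {f.
    (\<forall>x\<in>topspace T. \<forall>y\<in>topspace T. f (x + y) = f x + f y) \<and>
    (\<forall>c. \<forall>x\<in>topspace T. f (smul c x) = c * f x) \<and>
    continuous_map T euclidean f \<and>
    (\<forall>x. x \<notin> topspace T \<longrightarrow> f x = 0)}"

definition fun_scale :: "'k::real_or_complex \<Rightarrow> ('a \<Rightarrow> 'k) \<Rightarrow> ('a \<Rightarrow> 'k)"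
  where "fun_scale c f = (\<lambda>x. c * f x)"

definition weak_star ::
    "('k::real_or_complex \<Rightarrow> 'a::ab_group_add \<Rightarrow> 'a) \<Rightarrow> 'a topology \<Rightarrow> ('a \<Rightarrow> 'k) topology"
  where "weak_star smul T = topology_generated_by
    {{f \<in> dual_space smul T. f x \<in> W} | x W. x \<in> topspace T \<and> open W}"

definition polar ::
    "('k::real_or_complex \<Rightarrow> 'a::ab_group_add \<Rightarrow> 'a) \<Rightarrow> 'a topology \<Rightarrow> 'a set \<Rightarrow> ('a \<Rightarrow> 'k) set"
  where "polar smul T A = {f \<in> dual_space smul T. \<forall>y\<in>A. re_part (f y) \<le> 1}"

definition support_function :: "('a \<Rightarrow> 'k::real_or_complex) set \<Rightarrow> 'a \<Rightarrow> ereal"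
  where "support_function B y = (SUP f\<in>B. ereal (re_part (f y)))"

definition countably_separated ::
    "('k::real_or_complex \<Rightarrow> 'a::ab_group_add \<Rightarrow> 'a) \<Rightarrow> 'a topology \<Rightarrow> bool"
  where "countably_separated smul T \<longleftrightarrow>
    (\<exists>U :: nat \<Rightarrow> 'a set.
      (\<forall>n. absolutely_convex smul (U n) \<and> closedin T (U n) \<and> null_nbhd T (U n)) \<and>
      (\<Inter>n. {y \<in> topspace T. support_function (polar smul T (U n)) y = 0}) = {0})"

definition coarser_topology :: "'a topology \<Rightarrow> 'a topology \<Rightarrow> bool"
  where "coarser_topology S T \<longleftrightarrow>
    topspace S = topspace T \<and> (\<forall>U. openin S U \<longrightarrow> openin T U)"

lemma vector_space_fun_scale: "vector_space (fun_scale :: 'k::real_or_complex \<Rightarrow> ('a \<Rightarrow> 'k) \<Rightarrow> _)"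
  by unfold_locales (auto simp: fun_scale_def fun_eq_iff algebra_simps)

lemma topspace_weak_star:
  assumes "topological_vector_space smul T"
  shows "topspace (weak_star smul T) = dual_space smul T"
proof -
  interpret vector_space smul
    using assms by (simp add: topological_vector_space_def)
  have "0 \<in> topspace T"
    using assms subspace_0 by (simp add: topological_vector_space_def)
  then show ?thesis
    unfolding weak_star_def topology_generated_by_topspace by blast
qed

lemma continuous_map_weak_star_eval:
  assumes "topological_vector_space smul T" "x \<in> topspace T"
  shows "continuous_map (weak_star smul T) euclidean (\<lambda>f. f x)"
  unfolding continuous_map_def
proof (intro conjI allI impI)
  fix W :: "'a set" assume W: "openin euclidean W"
  have "{f \<in> dual_space smul T. f x \<in> W} \<in>
      {{f \<in> dual_space smul T. f x \<in> W} | x W. x \<in> topspace T \<and> open W}"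
    using assms(2) W by auto
  then have "openin (weak_star smul T) {f \<in> dual_space smul T. f x \<in> W}"
    unfolding weak_star_def by (rule topology_generated_by_Basis)
  then show "openin (weak_star smul T) {f \<in> topspace (weak_star smul T). f x \<in> W}"
    by (simp add: topspace_weak_star[OF assms(1)])
qed auto

lemma continuous_map_into_weak_star:
  assumes T: "topological_vector_space smul T"
    and F: "F \<in> topspace Z \<rightarrow> dual_space smul T"
    and ev: "\<And>x. x \<in> topspace T \<Longrightarrow> continuous_map Z euclidean (\<lambda>z. F z x)"
  shows "continuous_map Z (weak_star smul T) F"
  unfolding weak_star_def
proof (rule continuous_on_generated_topo)
  fix U assume "U \<in> {{f \<in> dual_space smul T. f x \<in> W} | x W. x \<in> topspace T \<and> open W}"
  then obtain x W where U: "U = {f \<in> dual_space smul T. f x \<in> W}" "x \<in> topspace T" "open W"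
    by blast
  have "openin Z {z \<in> topspace Z. F z x \<in> W}"
    using ev[OF U(2)] U(3) by (simp add: continuous_map_def)
  also have "{z \<in> topspace Z. F z x \<in> W} = F -` U \<inter> topspace Z"
    using F U by auto
  finally show "openin Z (F -` U \<inter> topspace Z)" .
next
  show "F ` topspace Z \<subseteq> \<Union> {{f \<in> dual_space smul T. f x \<in> W} | x W. x \<in> topspace T \<and> open W}"
    using F topspace_weak_star[OF T] unfolding weak_star_def topology_generated_by_topspace by auto
qed

lemma subspace_dual_space:
  assumes "topological_vector_space smul T"
  shows "module.subspace fun_scale (dual_space smul T)"
proof -
  interpret v: vector_space "fun_scale :: 'a \<Rightarrow> ('b \<Rightarrow> 'a) \<Rightarrow> _" by (rule vector_space_fun_scale)
  have cadd: "continuous_map T euclidean (\<lambda>x. f x + g x)"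
    if "continuous_map T euclidean f" "continuous_map T euclidean g" for f g :: "'b \<Rightarrow> 'a"
    using that by (rule continuous_map_add)
  have cmul: "continuous_map T euclidean (\<lambda>x. c * f x)"
    if "continuous_map T euclidean f" for c and f :: "'b \<Rightarrow> 'a"
    using continuous_map_compose[OF that, of euclidean "\<lambda>z. c * z"]
    by (simp add: o_def continuous_on_mult_left)
  show ?thesis
    unfolding v.subspace_def
    by (auto simp: dual_space_def fun_scale_def plus_fun_def zero_fun_def algebra_simps
        intro: cadd cmul)
qed

lemma Hausdorff_weak_star:
  assumes T: "topological_vector_space smul T"
  shows "Hausdorff_space (weak_star smul T)"
  unfolding Hausdorff_space_def topspace_weak_star[OF T]
proof (intro allI impI, elim conjE)
  fix f g assume f: "f \<in> dual_space smul T" and g: "g \<in> dual_space smul T" and "f \<noteq> g"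
  then obtain x where x: "f x \<noteq> g x" by (auto simp: fun_eq_iff)
  then have xT: "x \<in> topspace T" using f g by (metis (mono_tags, lifting) dual_space_def mem_Collect_eq)
  obtain U V where UV: "open U" "open V" "f x \<in> U" "g x \<in> V" "U \<inter> V = {}"
    using hausdorff[OF x] by blast
  have op: "openin (weak_star smul T) {h \<in> dual_space smul T. h x \<in> W}" if "open W" for W
    using continuous_map_weak_star_eval[OF T xT] that
    by (simp add: continuous_map_def topspace_weak_star[OF T])
  show "\<exists>U V. openin (weak_star smul T) U \<and> openin (weak_star smul T) V \<and>
      f \<in> U \<and> g \<in> V \<and> disjnt U V"
    by (rule exI[of _ "{h \<in> dual_space smul T. h x \<in> U}"],
        rule exI[of _ "{h \<in> dual_space smul T. h x \<in> V}"])
      (use UV f g op in \<open>auto simp: disjnt_def\<close>)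
qed

lemma locally_convex_weak_star:
  assumes T: "topological_vector_space smul T"
  shows "locally_convex_space fun_scale (weak_star smul T)"
proof -
  let ?D = "dual_space smul T" and ?w = "weak_star smul T"
  interpret v: vector_space "fun_scale :: 'a \<Rightarrow> ('b \<Rightarrow> 'a) \<Rightarrow> _" by (rule vector_space_fun_scale)
  have sub: "v.subspace ?D" by (rule subspace_dual_space[OF T])
  note tw = topspace_weak_star[OF T]
  note ev = continuous_map_weak_star_eval[OF T]
  have add: "continuous_map (prod_topology ?w ?w) ?w (\<lambda>(f, g). f + g)"
  proof (rule continuous_map_into_weak_star[OF T])
    show "(\<lambda>(f, g). f + g) \<in> topspace (prod_topology ?w ?w) \<rightarrow> ?D"
      using v.subspace_add[OF sub] by (auto simp: tw)
  next
    fix x assume x: "x \<in> topspace T"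
    have "continuous_map (prod_topology ?w ?w) euclidean (\<lambda>p. fst p x + snd p x)"
      using continuous_map_compose[OF continuous_map_fst ev[OF x]]
        continuous_map_compose[OF continuous_map_snd ev[OF x]]
      by (auto simp: o_def intro!: continuous_map_add)
    then show "continuous_map (prod_topology ?w ?w) euclidean (\<lambda>p. (case p of (f, g) \<Rightarrow> f + g) x)"
      by (simp add: case_prod_unfold)
  qed
  have mult: "continuous_map (prod_topology euclidean ?w) ?w (\<lambda>(c, f). fun_scale c f)"
  proof (rule continuous_map_into_weak_star[OF T])
    show "(\<lambda>(c, f). fun_scale c f) \<in> topspace (prod_topology euclidean ?w) \<rightarrow> ?D"
      using v.subspace_scale[OF sub] by (auto simp: tw)
  next
    fix x assume x: "x \<in> topspace T"
    have p: "continuous_map (prod_topology euclidean ?w) (prod_topology euclidean euclidean)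
        (\<lambda>p. (fst p, snd p x))"
      using continuous_map_compose[OF continuous_map_snd ev[OF x], of euclidean]
      by (simp only: continuous_map_paired continuous_map_fst o_def simp_thms)
    have m: "continuous_map (prod_topology euclidean euclidean) euclidean (\<lambda>(c, d). c * d :: 'a)"
      unfolding prod_topology_euclidean case_prod_unfold continuous_map_iff_continuous2
      by (intro continuous_intros)
    show "continuous_map (prod_topology euclidean ?w) euclidean
        (\<lambda>p. (case p of (c, f) \<Rightarrow> fun_scale c f) x)"
      using continuous_map_compose[OF p m] by (simp add: o_def case_prod_unfold fun_scale_def)
  qed
  let ?B = "{{f \<in> ?D. f x \<in> W} | x W. x \<in> topspace T \<and> open W}"
  have conv: "\<forall>f\<in>V. \<exists>C. openin ?w C \<and> convex_wrt fun_scale C \<and> f \<in> C \<and> C \<subseteq> V"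
    if "generate_topology_on ?B V" for V
    using that
  proof induction
    case (Int U V)
    show ?case
    proof
      fix f assume "f \<in> U \<inter> V"
      then obtain C C' where "openin ?w C" "convex_wrt fun_scale C" "f \<in> C" "C \<subseteq> U"
        "openin ?w C'" "convex_wrt fun_scale C'" "f \<in> C'" "C' \<subseteq> V"
        using Int.IH by (meson IntE)
      then show "\<exists>C. openin ?w C \<and> convex_wrt fun_scale C \<and> f \<in> C \<and> C \<subseteq> U \<inter> V"
        by (intro exI[of _ "C \<inter> C'"]) (auto simp: convex_wrt_def)
    qed
  next
    case (UN K)
    then show ?case by (meson UnionE Union_upper order_trans)
  next
    case (Basis V)
    then obtain x W where V: "V = {f \<in> ?D. f x \<in> W}" and x: "x \<in> topspace T" and W: "open W"
      by blast
    show ?case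
    proof
      fix f assume f: "f \<in> V"
      then have "f x \<in> W" by (simp add: V)
      then obtain e where e: "e > 0" "ball (f x) e \<subseteq> W"
        by (rule openE[OF W])
      let ?C = "{h \<in> ?D. h x \<in> ball (f x) e}"
      have "openin ?w ?C"
        using openin_continuous_map_preimage[OF ev[OF x], of "ball (f x) e"] by (simp add: tw)
      moreover have "convex_wrt fun_scale ?C"
        unfolding convex_wrt_def
      proof (intro ballI allI impI)
        fix h k and u v :: real
        assume hk: "h \<in> ?C" "k \<in> ?C" and uv: "0 \<le> u" "0 \<le> v" "u + v = 1"
        have "u *\<^sub>R h x + v *\<^sub>R k x \<in> ball (f x) e"
          by (rule convexD[OF convex_ball]) (use hk uv in simp_all)
        moreover have "fun_scale (of_real u) h + fun_scale (of_real v) k \<in> ?D"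
          using hk by (intro v.subspace_add[OF sub] v.subspace_scale[OF sub]) auto
        ultimately show "fun_scale (of_real u) h + fun_scale (of_real v) k \<in> ?C"
          by (simp add: fun_scale_def scaleR_conv_of_real del: mem_ball)
      qed
      ultimately show "\<exists>C. openin ?w C \<and> convex_wrt fun_scale C \<and> f \<in> C \<and> C \<subseteq> V"
        using f e V by (intro exI[of _ ?C]) (simp add: subset_iff)
    qed
  qed auto
  have lc: "\<exists>C. null_nbhd ?w C \<and> convex_wrt fun_scale C \<and> C \<subseteq> U" if "null_nbhd ?w U" for U
  proof -
    obtain V where V: "openin ?w V" "0 \<in> V" "V \<subseteq> U" using \<open>null_nbhd ?w U\<close> by (auto simp: null_nbhd_def)
    then have "generate_topology_on ?B V"
      unfolding weak_star_def by (intro openin_topology_generated_by)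
    then obtain C where "openin ?w C" "convex_wrt fun_scale C" "0 \<in> C" "C \<subseteq> V"
      using conv V(2) by blast
    then show ?thesis
      using V(3) openin_subset[of ?w C] unfolding null_nbhd_def
      by (intro exI[of _ C]) (meson order_refl order_trans)
  qed
  show ?thesis
    unfolding locally_convex_space_def topological_vector_space_def
    using vector_space_fun_scale sub add mult lc by (auto simp: tw)
qed

end

theory Submission
  imports Defs
begin

text \<open>
  Everything goes through one condition: some countable subset \<open>D\<close> of the space is total, that
  is, only the zero functional of the dual vanishes on \<open>D\<close>.

  If the space is separable, a countable dense set is total by continuity. Conversely, let \<open>D\<close>
  be countable and total. Combinations of members of \<open>D\<close> with coefficients in a countable dense
  subring of the scalars form a countable set, whose closure is a closed linear subspace. By
  Hahn-Banach a proper closed subspace of a locally convex space is annihilated by a nonzero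
  functional, so totality makes this closure the whole space
  (\<open>separable_if_countable_total_set\<close>).

  A total sequence \<open>(x\<^sub>n)\<close> gives the sets \<open>{f. \<bar>f x\<^sub>n\<bar> \<le> 1}\<close>, which witness countable separation
  of the dual, and it gives the topology of pointwise convergence at the \<open>x\<^sub>n\<close>, which embeds the
  dual into the metrizable space of scalar sequences and is locally convex.

  Conversely, a null neighbourhood of the weak topology restrains a functional at finitely many
  points only, so it contains the common annihilator of some finite set. Hence countably many
  null neighbourhoods contain the common annihilator of a countable set \<open>D\<close>
  (\<open>countable_weak_star_null_nbhds\<close>). If the neighbourhoods come from countable separation, or
  form a neighbourhood base of \<open>0\<close> in a coarser metrizable topology, then the annihilator of
  \<open>D\<close> is trivial, so \<open>D\<close> is total.

  The Hahn-Banach theorem is obtained here without extending functionals from subspaces: a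
  minimal sublinear functional is linear, and Zorn's lemma provides one below any given
  sublinear functional. Applied to the gauge of \<open>M + C\<close>, with \<open>M\<close> the closed subspace and \<open>C\<close> a
  convex neighbourhood, this gives a functional that vanishes on \<open>M\<close>.
\<close>

section \<open>Linear functionals below sublinear ones\<close>

text \<open>
  The theorem of Hahn and Banach is about real scalars, so the scalar multiplication here is the
  restriction to the reals. The space is a subspace of the type, as is the carrier of a topology.
\<close>

locale real_subspace = vector_space scl
  for scl :: "real \<Rightarrow> 'a::ab_group_add \<Rightarrow> 'a" +
  fixes X :: "'a set"
  assumes subspace_X: "subspace X"
begin

lemma carrier_closed [simp, intro]:
  "0 \<in> X"
  "x \<in> X \<Longrightarrow> y \<in> X \<Longrightarrow> x + y \<in> X"
  "x \<in> X \<Longrightarrow> y \<in> X \<Longrightarrow> x - y \<in> X"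
  "x \<in> X \<Longrightarrow> - x \<in> X"
  "x \<in> X \<Longrightarrow> scl c x \<in> X"
  using subspace_X
  by (simp_all add: subspace_0 subspace_add subspace_diff subspace_neg subspace_scale)

text \<open>
  For positive homogeneity an inequality suffices: applying it to \<open>c\<close> and to \<open>1 / c\<close> gives
  equality.
\<close>

definition sublinear :: "('a \<Rightarrow> real) \<Rightarrow> bool"
  where "sublinear p \<longleftrightarrow>
    (\<forall>x\<in>X. \<forall>y\<in>X. p (x + y) \<le> p x + p y) \<and> (\<forall>c>0. \<forall>x\<in>X. p (scl c x) \<le> c * p x)"

lemma sublinear_add: "sublinear p \<Longrightarrow> x \<in> X \<Longrightarrow> y \<in> X \<Longrightarrow> p (x + y) \<le> p x + p y"
  by (simp add: sublinear_def)

lemma sublinear_scale: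
  assumes p: "sublinear p" and c: "c > 0" and x: "x \<in> X"
  shows "p (scl c x) = c * p x"
proof (rule antisym)
  show "p (scl c x) \<le> c * p x" using assms by (simp add: sublinear_def)
  have "p (scl (1 / c) (scl c x)) \<le> (1 / c) * p (scl c x)"
    using assms unfolding sublinear_def by (meson carrier_closed(5) zero_less_divide_1_iff)
  then show "c * p x \<le> p (scl c x)"
    using c by (simp add: field_simps)
qed

lemma sublinear_0:
  assumes "sublinear p"
  shows "p 0 = 0"
proof -
  have "p (scl 2 0) = 2 * p 0" using assms by (intro sublinear_scale) auto
  then have "p 0 = 2 * p 0" unfolding scale_zero_right .
  then show ?thesis by linarith
qed

lemma sublinear_neg: "sublinear p \<Longrightarrow> x \<in> X \<Longrightarrow> - p (- x) \<le> p x"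
  using sublinear_add[of p x "- x"] sublinear_0[of p] by simp

text \<open>
  Lowering a sublinear functional as far as possible along the ray spanned by \<open>y\<close> makes its
  value at \<open>- y\<close> at most \<open>- p y\<close>, so that the result is additive in the direction of \<open>y\<close>.
\<close>

definition lower_along :: "'a \<Rightarrow> ('a \<Rightarrow> real) \<Rightarrow> 'a \<Rightarrow> real"
  where "lower_along y p x = (INF t\<in>{0..}. p (x + scl t y) - t * p y)"

lemma lower_along_bound:
  assumes p: "sublinear p" and "x \<in> X" "y \<in> X" "t \<ge> 0"
  shows "- p (- x) \<le> p (x + scl t y) - t * p y"
proof -
  have "p (scl t y) = t * p y"
    using sublinear_scale[OF p, of t y] sublinear_0[OF p] assms by (cases "t = 0") auto
  moreover have "p ((x + scl t y) + - x) \<le> p (x + scl t y) + p (- x)"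
    using assms by (intro sublinear_add[OF p]) auto
  ultimately show ?thesis by simp
qed

lemma lower_along_le:
  assumes "sublinear p" "x \<in> X" "y \<in> X" "t \<ge> 0"
  shows "lower_along y p x \<le> p (x + scl t y) - t * p y"
  unfolding lower_along_def using assms lower_along_bound[OF assms(1-3)]
  by (intro cINF_lower bdd_belowI2[where m = "- p (- x)"]) auto

lemma lower_along_greatest:
  "(\<And>t. t \<ge> 0 \<Longrightarrow> z \<le> p (x + scl t y) - t * p y) \<Longrightarrow> z \<le> lower_along y p x"
  unfolding lower_along_def by (intro cINF_greatest) auto

lemma lower_along_le_self:
  "sublinear p \<Longrightarrow> x \<in> X \<Longrightarrow> y \<in> X \<Longrightarrow> lower_along y p x \<le> p x"
  using lower_along_le[of p x y 0] by simp

lemma lower_along_neg: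
  "sublinear p \<Longrightarrow> y \<in> X \<Longrightarrow> lower_along y p (- y) \<le> - p y"
  using lower_along_le[of p "- y" y 1] sublinear_0[of p] by simp

lemma sublinear_lower_along:
  assumes p: "sublinear p" and y: "y \<in> X"
  shows "sublinear (lower_along y p)"
  unfolding sublinear_def
proof (intro conjI ballI allI impI)
  fix a b assume ab: "a \<in> X" "b \<in> X"
  \<comment> \<open>Move by \<open>s\<close> from \<open>a\<close> and by \<open>t\<close> from \<open>b\<close>, then take the infimum over each separately.\<close>
  have sum: "lower_along y p (a + b) \<le> (p (a + scl s y) - s * p y) + (p (b + scl t y) - t * p y)"
    if "s \<ge> 0" "t \<ge> 0" for s t
  proof -
    have "lower_along y p (a + b) \<le> p ((a + b) + scl (s + t) y) - (s + t) * p y"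
      using that ab by (intro lower_along_le[OF p _ y]) auto
    also have "(a + b) + scl (s + t) y = (a + scl s y) + (b + scl t y)"
      by (simp add: scale_left_distrib)
    also have "p \<dots> \<le> p (a + scl s y) + p (b + scl t y)"
      using ab y by (intro sublinear_add[OF p]) auto
    finally show ?thesis by (simp add: algebra_simps)
  qed
  have "lower_along y p (a + b) - (p (a + scl s y) - s * p y) \<le> lower_along y p b"
    if "s \<ge> 0" for s
    using sum[OF that] by (intro lower_along_greatest) (simp add: algebra_simps)
  then have "lower_along y p (a + b) - lower_along y p b \<le> lower_along y p a"
    by (intro lower_along_greatest) (simp add: algebra_simps)
  then show "lower_along y p (a + b) \<le> lower_along y p a + lower_along y p b" by simp
next
  fix c :: real and x assume c: "c > 0" and x: "x \<in> X"
  have "lower_along y p (scl c x) / c \<le> p (x + scl t y) - t * p y" if "t \<ge> 0" for t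
  proof -
    have "lower_along y p (scl c x) \<le> p (scl c x + scl (c * t) y) - (c * t) * p y"
      using that c x by (intro lower_along_le[OF p _ y]) auto
    also have "scl c x + scl (c * t) y = scl c (x + scl t y)"
      by (simp add: scale_right_distrib)
    also have "p \<dots> = c * p (x + scl t y)"
      using c x y by (intro sublinear_scale[OF p]) auto
    finally show ?thesis using c by (simp add: field_simps)
  qed
  then have "lower_along y p (scl c x) / c \<le> lower_along y p x"
    by (rule lower_along_greatest)
  then show "lower_along y p (scl c x) \<le> c * lower_along y p x"
    using c by (simp add: field_simps)
qed

definition linear_functional :: "('a \<Rightarrow> real) \<Rightarrow> bool"
  where "linear_functional l \<longleftrightarrow>
    (\<forall>x\<in>X. \<forall>y\<in>X. l (x + y) = l x + l y) \<and> (\<forall>c. \<forall>x\<in>X. l (scl c x) = c * l x)"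

text \<open>Oddness turns subadditivity into additivity: estimate \<open>p ((x + y) + (- y))\<close>.\<close>

lemma linear_functional_if_odd:
  assumes p: "sublinear p" and odd: "\<And>x. x \<in> X \<Longrightarrow> p (- x) \<le> - p x"
  shows "linear_functional p"
proof -
  have neg: "p (- x) = - p x" if "x \<in> X" for x
    using odd[OF that] sublinear_neg[OF p that] by simp
  have "p x + p y \<le> p (x + y)" if "x \<in> X" "y \<in> X" for x y
    using sublinear_add[OF p, of "x + y" "- y"] that neg by auto
  moreover have "p (scl c x) = c * p x" if x: "x \<in> X" for c x
  proof -
    consider "c > 0" | "c = 0" | "c < 0" by linarith
    then show ?thesis
    proof cases
      case 3
      have "p (scl c x) = p (- scl (- c) x)" by simp
      also have "\<dots> = c * p x"
        using neg[of "scl (- c) x"] sublinear_scale[OF p, of "- c" x] 3 x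
        by (metis carrier_closed(5) minus_mult_left neg_0_less_iff_less verit_minus_simplify(4))
      finally show ?thesis .
    qed (use sublinear_scale[OF p] sublinear_0[OF p] x in auto)
  qed
  ultimately show ?thesis
    using sublinear_add[OF p] unfolding linear_functional_def by (meson antisym)
qed

text \<open>
  The infimum is finite because every member of \<open>C\<close> lies above \<open>\<lambda>x. - p (- x)\<close>. For the chain
  in Zorn's lemma it is the bound; comparability of the members keeps it subadditive.
\<close>

lemma sublinear_INF_chain:
  assumes ne: "C \<noteq> {}" and sub: "\<And>q. q \<in> C \<Longrightarrow> sublinear q"
    and below: "\<And>q x. q \<in> C \<Longrightarrow> x \<in> X \<Longrightarrow> q x \<le> p x"
    and chain: "\<And>q r. q \<in> C \<Longrightarrow> r \<in> C \<Longrightarrow> (\<forall>x\<in>X. q x \<le> r x) \<or> (\<forall>x\<in>X. r x \<le> q x)"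
  shows "sublinear (\<lambda>x. INF q\<in>C. q x)"
    and "\<And>q x. q \<in> C \<Longrightarrow> x \<in> X \<Longrightarrow> (INF q\<in>C. q x) \<le> q x"
proof -
  show lower: "(INF q\<in>C. q x) \<le> q x" if "q \<in> C" "x \<in> X" for q x
  proof (rule cINF_lower[OF _ that(1)])
    have "- p (- x) \<le> r x" if "r \<in> C" for r
      using sublinear_neg[OF sub[OF that], of x] below[OF that, of "- x"] \<open>x \<in> X\<close> by auto
    then show "bdd_below ((\<lambda>q. q x) ` C)" by (intro bdd_belowI2)
  qed
  show "sublinear (\<lambda>x. INF q\<in>C. q x)"
    unfolding sublinear_def
  proof (intro conjI ballI allI impI)
    fix x y assume xy: "x \<in> X" "y \<in> X"
    have sum: "(INF q\<in>C. q (x + y)) \<le> q x + r y" if qr: "q \<in> C" "r \<in> C" for q r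
    proof -
      \<comment> \<open>In a chain the smaller of \<open>q\<close> and \<open>r\<close> serves both arguments.\<close>
      obtain s where s: "s \<in> C" "s x \<le> q x" "s y \<le> r y"
        using chain[OF qr] qr xy by blast
      have "(INF q\<in>C. q (x + y)) \<le> s (x + y)" using lower[OF s(1)] xy by auto
      also have "\<dots> \<le> s x + s y" using sublinear_add[OF sub[OF s(1)]] xy by auto
      finally show ?thesis using s by linarith
    qed
    have "(INF q\<in>C. q (x + y)) - q x \<le> (INF r\<in>C. r y)" if "q \<in> C" for q
      using sum[OF that] by (intro cINF_greatest[OF ne]) (simp add: algebra_simps)
    then have "(INF q\<in>C. q (x + y)) - (INF r\<in>C. r y) \<le> (INF q\<in>C. q x)"
      by (intro cINF_greatest[OF ne]) (simp add: algebra_simps)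
    then show "(INF q\<in>C. q (x + y)) \<le> (INF q\<in>C. q x) + (INF q\<in>C. q y)" by simp
  next
    fix c :: real and x assume c: "c > 0" and x: "x \<in> X"
    have "(INF q\<in>C. q (scl c x)) / c \<le> (INF q\<in>C. q x)"
    proof (rule cINF_greatest[OF ne])
      fix q assume q: "q \<in> C"
      have "(INF q\<in>C. q (scl c x)) \<le> c * q x"
        using lower[OF q, of "scl c x"] sublinear_scale[OF sub[OF q] c x] x by simp
      then show "(INF q\<in>C. q (scl c x)) / c \<le> q x" using c by (simp add: field_simps)
    qed
    then show "(INF q\<in>C. q (scl c x)) \<le> c * (INF q\<in>C. q x)" using c by (simp add: field_simps)
  qed
qed

lemma sublinear_cong:
  assumes "\<And>x. x \<in> X \<Longrightarrow> p x = q x"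
  shows "sublinear p \<longleftrightarrow> sublinear q"
  using assms by (simp add: sublinear_def)

text \<open>
  Zorn's lemma yields a minimal sublinear functional below \<open>p\<close>. Lowering it along any \<open>y\<close>
  cannot change it, so it is odd and hence linear.
\<close>

theorem linear_functional_below_sublinear:
  assumes p: "sublinear p"
  obtains l where "linear_functional l" "\<And>x. x \<in> X \<Longrightarrow> l x \<le> p x"
proof -
  \<comment> \<open>Normalising to \<open>0\<close> outside the carrier makes the pointwise order antisymmetric.\<close>
  define A where "A = {q. sublinear q \<and> (\<forall>x\<in>X. q x \<le> p x) \<and> (\<forall>x. x \<notin> X \<longrightarrow> q x = 0)}"
  define R where "R q r \<longleftrightarrow> (\<forall>x\<in>X. r x \<le> q x)" for q r :: "'a \<Rightarrow> real"
  define cut where "cut q x = (if x \<in> X then q x else 0)" for q :: "'a \<Rightarrow> real" and x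
  have cut_A: "cut q \<in> A" if "sublinear q" "\<forall>x\<in>X. q x \<le> p x" for q
    using that sublinear_cong[of "cut q" q] by (simp add: A_def cut_def)
  have "\<exists>m\<in>A. \<forall>q\<in>A. R m q \<longrightarrow> q = m"
  proof (rule predicate_Zorn)
    show "partial_order_on A (relation_of R A)"
    proof (rule partial_order_on_relation_ofI)
      fix a b assume *: "a \<in> A" "b \<in> A" "R a b" "R b a"
      have "a x = b x" for x
      proof (cases "x \<in> X")
        case True
        then have "a x \<le> b x" "b x \<le> a x" using *(3,4) unfolding R_def by blast+
        then show ?thesis by simp
      next
        case False
        then show ?thesis using *(1,2) unfolding A_def by simp
      qed
      then show "a = b" by blast
    next
      fix a b c assume "R a b" "R b c"
      then show "R a c" unfolding R_def by (meson order_trans)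
    qed (simp add: R_def)
  next
    fix C assume "C \<in> Chains (relation_of R A)"
    then have C: "C \<subseteq> A" and chain: "\<And>q r. q \<in> C \<Longrightarrow> r \<in> C \<Longrightarrow> R q r \<or> R r q"
      unfolding Chains_def relation_of_def by auto
    show "\<exists>u\<in>A. \<forall>a\<in>C. R a u"
    proof (cases "C = {}")
      case True
      then show ?thesis using cut_A[OF p] by auto
    next
      case False
      let ?u = "\<lambda>x. INF q\<in>C. q x"
      have *: "sublinear ?u" "\<And>q x. q \<in> C \<Longrightarrow> x \<in> X \<Longrightarrow> ?u x \<le> q x"
        using sublinear_INF_chain[OF False, of p] C chain unfolding A_def R_def by blast+
      have "?u x \<le> p x" if x: "x \<in> X" for x
      proof -
        obtain q where "q \<in> C" using False by blast
        then have "?u x \<le> q x" "q x \<le> p x" using *(2)[OF _ x] C x by (auto simp: A_def)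
        then show ?thesis by linarith
      qed
      then have "cut ?u \<in> A" using *(1) by (intro cut_A) auto
      moreover have "\<forall>a\<in>C. R a (cut ?u)" using *(2) by (auto simp: R_def cut_def)
      ultimately show ?thesis by blast
    qed
  qed
  then obtain m where m: "m \<in> A" and min: "\<And>q. q \<in> A \<Longrightarrow> R m q \<Longrightarrow> q = m" by blast
  have sm: "sublinear m" and mp: "\<And>x. x \<in> X \<Longrightarrow> m x \<le> p x" using m by (auto simp: A_def)
  have "m (- y) \<le> - m y" if y: "y \<in> X" for y
  proof -
    have le: "lower_along y m x \<le> m x" if "x \<in> X" for x
      using lower_along_le_self[OF sm that y] .
    then have "\<forall>x\<in>X. lower_along y m x \<le> p x" using mp order_trans by blast
    then have "cut (lower_along y m) \<in> A"
      by (rule cut_A[OF sublinear_lower_along[OF sm y]])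
    moreover have "R m (cut (lower_along y m))" using le by (simp add: R_def cut_def)
    ultimately have "cut (lower_along y m) = m" by (rule min)
    then have "m (- y) = lower_along y m (- y)" using y by (metis cut_def carrier_closed(4))
    then show ?thesis using lower_along_neg[OF sm y] by simp
  qed
  then show thesis using that linear_functional_if_odd[OF sm] mp by blast
qed

text \<open>
  Applying the existence result to \<open>p\<close> lowered along \<open>y\<close> forces the value at \<open>y\<close>, since
  then \<open>l (- y) \<le> - p y\<close>.
\<close>

corollary linear_functional_touching_sublinear:
  assumes p: "sublinear p" and y: "y \<in> X"
  obtains l where "linear_functional l" "\<And>x. x \<in> X \<Longrightarrow> l x \<le> p x" "l y = p y"
proof -
  obtain l where l: "linear_functional l" and le: "\<And>x. x \<in> X \<Longrightarrow> l x \<le> lower_along y p x"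
    using linear_functional_below_sublinear[OF sublinear_lower_along[OF p y]] by blast
  have lp: "l x \<le> p x" if "x \<in> X" for x
    using le[OF that] lower_along_le_self[OF p that y] by linarith
  have "l (scl (- 1) y) = (- 1) * l y" using l y unfolding linear_functional_def by blast
  then have "l (- y) = - l y" by simp
  then have "p y \<le> l y" using le[of "- y"] lower_along_neg[OF p y] y by auto
  then show thesis using that[OF l lp] lp[OF y] by (simp add: antisym)
qed

text \<open>
  The functional is dominated by the gauge of the convex set \<open>M + C\<close>, which is \<open>0\<close> on \<open>M\<close>, at
  most \<open>1\<close> on \<open>C\<close> and at least \<open>1\<close> at \<open>x0\<close>.
\<close>

theorem linear_functional_separating:
  assumes M: "subspace M" "M \<subseteq> X"
    and CX: "C \<subseteq> X" and C0: "0 \<in> C"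
    and convex: "\<And>x y u v. x \<in> C \<Longrightarrow> y \<in> C \<Longrightarrow> 0 \<le> u \<Longrightarrow> 0 \<le> v \<Longrightarrow> u + v = 1
      \<Longrightarrow> scl u x + scl v y \<in> C"
    and absorbing: "\<And>x. x \<in> X \<Longrightarrow> \<exists>t>0. scl t x \<in> C"
    and x0: "x0 \<in> X" "\<And>c. c \<in> C \<Longrightarrow> x0 - c \<notin> M"
  obtains l where "linear_functional l" "\<And>x. x \<in> M \<Longrightarrow> l x = 0"
    "\<And>x. x \<in> C \<Longrightarrow> l x \<le> 1" "l x0 > 0"
proof -
  \<comment> \<open>The gauge of \<open>M + C\<close>, written without scaling \<open>m\<close>, since \<open>M\<close> is a subspace.\<close>
  define G where "G x = {t. t > 0 \<and> (\<exists>m\<in>M. \<exists>c\<in>C. x = m + scl t c)}" for x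
  define p where "p x = Inf (G x)" for x
  have p_le: "p x \<le> t" if "t \<in> G x" for x t
    unfolding p_def using that by (intro cInf_lower bdd_belowI[of _ 0]) (auto simp: G_def)
  have ne: "G x \<noteq> {}" if x: "x \<in> X" for x
  proof -
    obtain t where t: "t > 0" "scl t x \<in> C" using absorbing[OF x] by blast
    then have "x = 0 + scl (1 / t) (scl t x)" by simp
    then have "1 / t \<in> G x" unfolding G_def using t subspace_0[OF M(1)] by fastforce
    then show ?thesis by blast
  qed
  have p_ge: "z \<le> p x" if "x \<in> X" "\<And>t. t \<in> G x \<Longrightarrow> z \<le> t" for x z
    unfolding p_def using that ne by (intro cInf_greatest) auto
  have G_add: "s + t \<in> G (x + y)" if st: "s \<in> G x" "t \<in> G y" for s t x y
  proof -
    obtain m n c d where mn: "m \<in> M" "n \<in> M" "c \<in> C" "d \<in> C"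
      "x = m + scl s c" "y = n + scl t d" "s > 0" "t > 0"
      using st by (auto simp: G_def)
    define e where "e = scl (s / (s + t)) c + scl (t / (s + t)) d"
    have "e \<in> C" unfolding e_def using mn
      by (intro convex) (auto simp: add_divide_distrib[symmetric])
    moreover have "x + y = (m + n) + scl (s + t) e"
      using mn by (simp add: e_def scale_right_distrib)
    ultimately show ?thesis
      unfolding G_def using mn subspace_add[OF M(1)] by fastforce
  qed
  have G_scale: "c * t \<in> G (scl c x)" if c: "c > 0" and t: "t \<in> G x" for c t x
  proof -
    obtain m d where md: "m \<in> M" "d \<in> C" "x = m + scl t d" "t > 0"
      using t by (auto simp: G_def)
    then have "scl c x = scl c m + scl (c * t) d" by (simp add: scale_right_distrib)
    then show ?thesis
      unfolding G_def using md c subspace_scale[OF M(1)] by fastforce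
  qed
  have "sublinear p"
    unfolding sublinear_def
  proof (intro conjI ballI allI impI)
    fix x y assume xy: "x \<in> X" "y \<in> X"
    \<comment> \<open>Pass to the infimum in one argument at a time.\<close>
    have "p (x + y) - t \<le> p x" if "t \<in> G y" for t
      using p_le[OF G_add[OF _ that]] xy(1) by (intro p_ge) (auto simp: algebra_simps)
    then have "p (x + y) - p x \<le> p y"
      using xy(2) by (intro p_ge) (auto simp: algebra_simps)
    then show "p (x + y) \<le> p x + p y" by simp
  next
    fix c :: real and x assume c: "c > 0" and x: "x \<in> X"
    have "p (scl c x) / c \<le> p x"
      using p_le[OF G_scale[OF c]] c x by (intro p_ge) (auto simp: field_simps)
    then show "p (scl c x) \<le> c * p x" using c by (simp add: field_simps)
  qed
  then obtain l where l: "linear_functional l" "\<And>x. x \<in> X \<Longrightarrow> l x \<le> p x" "l x0 = p x0"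
    using linear_functional_touching_sublinear x0(1) by blast
  have pM: "l x \<le> 0" if "x \<in> M" for x
  proof (rule field_le_epsilon)
    fix e :: real assume e: "e > 0"
    have "x = x + scl e 0" by simp
    then have "e \<in> G x" unfolding G_def using e that C0 by blast
    then show "l x \<le> 0 + e" using p_le[of e x] l(2)[of x] that M(2) by fastforce
  qed
  have "l x = 0" if x: "x \<in> M" for x
  proof -
    have "l (scl (- 1) x) = (- 1) * l x" using l(1) x M(2) unfolding linear_functional_def by blast
    then show ?thesis using pM[OF x] pM[of "- x"] subspace_neg[OF M(1) x] by simp
  qed
  moreover have "l x \<le> 1" if x: "x \<in> C" for x
  proof -
    have "x = 0 + scl 1 x" by simp
    then have "1 \<in> G x" unfolding G_def using x subspace_0[OF M(1)] by fastforce
    then show ?thesis using p_le[of 1 x] l(2)[of x] x CX by fastforce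
  qed
  moreover have "1 \<le> p x0"
  proof (rule p_ge[OF x0(1)])
    fix t assume "t \<in> G x0"
    then obtain m c where mc: "m \<in> M" "c \<in> C" "x0 = m + scl t c" "t > 0" by (auto simp: G_def)
    show "1 \<le> t"
    proof (rule ccontr)
      assume "\<not> 1 \<le> t"
      then have "scl t c + scl (1 - t) 0 \<in> C" using mc C0 by (intro convex) auto
      then show False using x0(2)[of "scl t c"] mc by simp
    qed
  qed
  ultimately show thesis using that[OF l(1)] l(3) by fastforce
qed

end

section \<open>Scalars\<close>

text \<open>Squaring gives \<open>a\<^sup>2 = - b\<^sup>2\<close> when \<open>im_unit\<close> is a square root of \<open>- 1\<close>.\<close>

lemma of_real_eq_im_unit_mult_of_realD:
  assumes "(of_real a :: 'k::real_or_complex) = im_unit * of_real b"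
  shows "a = 0"
proof (cases "(im_unit :: 'k) = 0")
  case False
  then have i: "im_unit * im_unit = (- 1 :: 'k)" using im_unit_cases by blast
  have "(of_real (a * a) :: 'k) = (im_unit * im_unit) * of_real (b * b)"
    using assms by (simp add: algebra_simps)
  also have "\<dots> = of_real (- (b * b))" unfolding i by simp
  finally have "a * a = - (b * b)" using of_real_eq_iff by blast
  then have "a * a + b * b = 0" by simp
  then show ?thesis by (simp add: sum_squares_eq_zero_iff)
qed (use assms in simp)

lemma scalar_decomp: "(z :: 'k::real_or_complex) = of_real (re_part z) + im_unit * of_real (im_part z)"
  using re_im_decomp[of z] by (simp add: scaleR_conv_of_real mult.commute)

lemma re_part_of_real [simp]: "re_part (of_real r :: 'k::real_or_complex) = r"
proof -
  let ?w = "of_real r :: 'k"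
  have "(of_real (r - re_part ?w) :: 'k) = im_unit * of_real (im_part ?w)"
    using scalar_decomp[of ?w] by (simp add: algebra_simps)
  then show ?thesis using of_real_eq_im_unit_mult_of_realD by fastforce
qed

lemma re_part_0 [simp]: "re_part (0 :: 'k::real_or_complex) = 0"
  using re_part_of_real[of 0] by simp

lemma re_part_le_norm: "re_part (z :: 'k::real_or_complex) \<le> norm z"
proof -
  have "(re_part z)\<^sup>2 \<le> (norm z)\<^sup>2" using norm_re_im[of z] by simp
  then show ?thesis by (simp add: abs_le_square_iff[symmetric])
qed

text \<open>
  If \<open>Re (c * z) \<le> 0\<close> on the closed unit disc of scalars \<open>c\<close>, then the choice that rotates \<open>z\<close>
  to \<open>norm z\<close> shows \<open>z = 0\<close>.
\<close>

lemma scalar_eq_0_if_re_part_nonpos: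
  fixes z :: "'k::real_or_complex"
  assumes "\<And>c. norm c \<le> 1 \<Longrightarrow> re_part (c * z) \<le> 0"
  shows "z = 0"
proof (rule ccontr)
  assume z: "z \<noteq> 0"
  then have "re_part ((of_real (norm z) / z) * z) \<le> 0" by (intro assms) (simp add: norm_divide)
  then show False using z by simp
qed

lemma scalar_eq_0_if_re_part_bounded:
  fixes z :: "'k::real_or_complex"
  assumes "\<And>c. re_part (c * z) \<le> b"
  shows "z = 0"
proof (rule ccontr)
  assume z: "z \<noteq> 0"
  have "re_part ((of_real (b + 1) / z) * z) \<le> b" by (rule assms)
  then have "re_part (of_real (b + 1) :: 'k) \<le> b" using z by simp
  then show False by (simp del: of_real_add)
qed

text \<open>
  The rationals, or the Gaussian rationals if \<open>im_unit\<close> is a square root of \<open>- 1\<close>. Closure under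
  multiplication is what makes the combinations with such coefficients stable under scaling.
\<close>

definition rational_scalars :: "'k::real_or_complex set"
  where "rational_scalars = (\<lambda>(a, b). of_real a + im_unit * of_real b) ` (\<rat> \<times> \<rat>)"

lemma countable_rational_scalars: "countable rational_scalars"
  unfolding rational_scalars_def by (intro countable_image countable_SIGMA) (simp_all add: countable_rat)

lemma closure_rational_scalars: "closure (rational_scalars :: 'k::real_or_complex set) = UNIV"
proof -
  let ?g = "\<lambda>(a, b). of_real a + im_unit * of_real b :: 'k"
  have "?g ` closure (\<rat> \<times> \<rat>) \<subseteq> closure (?g ` (\<rat> \<times> \<rat>))"
    by (intro image_closure_subset closure_subset) (auto simp: case_prod_unfold intro!: continuous_intros)
  moreover have "z \<in> ?g ` closure (\<rat> \<times> \<rat>)" for z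
  proof (rule image_eqI)
    show "z = ?g (re_part z, im_part z)" using scalar_decomp[of z] by simp
  qed (simp add: closure_Times Rats_closure_real)
  ultimately show ?thesis unfolding rational_scalars_def by blast
qed

lemma one_rational_scalars: "1 \<in> (rational_scalars :: 'k::real_or_complex set)"
  unfolding rational_scalars_def by (rule image_eqI[where x = "(1, 0)"]) auto

lemma rational_scalars_mult:
  assumes "(y :: 'k::real_or_complex) \<in> rational_scalars" "z \<in> rational_scalars"
  shows "y * z \<in> rational_scalars"
proof -
  obtain a b c d where ab: "a \<in> \<rat>" "b \<in> \<rat>" "c \<in> \<rat>" "d \<in> \<rat>"
    and y: "y = of_real a + im_unit * of_real b" and z: "z = of_real c + im_unit * of_real d"
    using assms by (auto simp: rational_scalars_def)
  obtain s where s: "s \<in> \<rat>" "im_unit * im_unit = (of_real s :: 'k)"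
    using im_unit_cases[where 'a = 'k] by (metis Rats_0 Rats_1 Rats_minus_iff mult_zero_left of_real_0 of_real_1 of_real_minus)
  have "y * z = of_real (a * c) + (im_unit * im_unit) * of_real (b * d) + im_unit * of_real (a * d + b * c)"
    unfolding y z by (simp add: algebra_simps)
  also have "\<dots> = of_real (a * c + s * (b * d)) + im_unit * of_real (a * d + b * c)"
    unfolding s(2) by simp
  finally show ?thesis
    unfolding rational_scalars_def using ab s(1)
    by (intro image_eqI[where x = "(a * c + s * (b * d), a * d + b * c)"]) auto
qed

section \<open>Vector spaces with a topology\<close>

lemma tvs_vector_space: "topological_vector_space smul T \<Longrightarrow> vector_space smul"
  and tvs_subspace: "topological_vector_space smul T \<Longrightarrow> module.subspace smul (topspace T)"
  and tvs_add: "topological_vector_space smul T \<Longrightarrow>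
    continuous_map (prod_topology T T) T (\<lambda>(x, y). x + y)"
  and tvs_scale: "topological_vector_space smul T \<Longrightarrow>
    continuous_map (prod_topology euclidean T) T (\<lambda>(c, x). smul c x)"
  by (simp_all add: topological_vector_space_def)

lemma continuous_map_tvs_scale:
  assumes "topological_vector_space smul T" "continuous_map Z euclidean c" "continuous_map Z T f"
  shows "continuous_map Z T (\<lambda>z. smul (c z) (f z))"
  using continuous_map_compose[OF continuous_map_pairedI[OF assms(2,3)] tvs_scale[OF assms(1)]]
  by (simp add: o_def)

lemma continuous_map_tvs_add:
  assumes "topological_vector_space smul T" "continuous_map Z T f" "continuous_map Z T g"
  shows "continuous_map Z T (\<lambda>z. f z + g z)"
  using continuous_map_compose[OF continuous_map_pairedI[OF assms(2,3)] tvs_add[OF assms(1)]]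
  by (simp add: o_def)

lemma continuous_map_affine:
  assumes T: "topological_vector_space smul T" and x: "x \<in> topspace T"
  shows "continuous_map T T (\<lambda>y. x + smul c y)"
  using x by (intro continuous_map_tvs_add[OF T] continuous_map_tvs_scale[OF T]) auto

lemma vector_space_real_scale:
  assumes "vector_space (smul :: 'k::real_or_complex \<Rightarrow> 'a::ab_group_add \<Rightarrow> 'a)"
  shows "vector_space (\<lambda>r. smul (of_real r))"
proof -
  interpret vector_space smul by fact
  show ?thesis
    by unfold_locales (simp_all add: scale_right_distrib scale_left_distrib)
qed

lemma subspace_real_scale:
  assumes V: "vector_space (smul :: 'k::real_or_complex \<Rightarrow> 'a::ab_group_add \<Rightarrow> 'a)"
    and M: "module.subspace smul M"
  shows "module.subspace (\<lambda>r. smul (of_real r)) M"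
proof -
  interpret vector_space smul by fact
  interpret r: vector_space "\<lambda>r. smul (of_real r)" by (rule vector_space_real_scale[OF V])
  show ?thesis using M unfolding r.subspace_def subspace_def by blast
qed

lemma real_subspace_tvs:
  assumes "topological_vector_space smul T"
  shows "real_subspace (\<lambda>r. smul (of_real r)) (topspace T)"
  unfolding real_subspace_def real_subspace_axioms_def
  using assms vector_space_real_scale subspace_real_scale tvs_vector_space tvs_subspace by blast

section \<open>Separation of points from closed subspaces by the dual\<close>

text \<open>
  Only a one-sided bound near \<open>0\<close> is needed, because it controls the increments of \<open>l\<close> in both
  directions: \<open>x - e V\<close> is a neighbourhood of \<open>x\<close> as much as \<open>x + e V\<close>.
\<close>

lemma continuous_map_linear_functional:
  assumes T: "topological_vector_space smul T"
    and l: "real_subspace.linear_functional (\<lambda>r. smul (of_real r)) (topspace T) l"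
    and V: "openin T V" "0 \<in> V" "\<And>x. x \<in> V \<Longrightarrow> l x \<le> 1"
  shows "continuous_map T euclideanreal l"
proof -
  let ?r = "\<lambda>r. smul (of_real r)"
  interpret real_subspace ?r "topspace T" by (rule real_subspace_tvs[OF T])
  have ladd: "l (x + y) = l x + l y" if "x \<in> topspace T" "y \<in> topspace T" for x y
    using l that by (simp add: linear_functional_def)
  have lscale: "l (?r c x) = c * l x" if "x \<in> topspace T" for c x
    using l that by (simp add: linear_functional_def)
  have "openin T {x \<in> topspace T. s * l x < a}" for s a :: real
  proof (subst openin_subopen, clarify)
    fix x assume x: "x \<in> topspace T" and lx: "s * l x < a"
    \<comment> \<open>The neighbourhood is \<open>{y. s * (y - x) / e \<in> V}\<close>, on which \<open>s * l y \<le> s * l x + e = b\<close>.\<close>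
    obtain b where b: "s * l x < b" "b < a" using dense[OF lx] by blast
    define e where "e = b - s * l x"
    have e: "e > 0" using b(1) by (simp add: e_def)
    let ?h = "\<lambda>y. ?r (- s / e) x + ?r (s / e) y"
    let ?W = "{y \<in> topspace T. ?h y \<in> V}"
    have "openin T ?W"
      by (rule openin_continuous_map_preimage[OF continuous_map_affine[OF T] V(1)])
        (rule carrier_closed(5)[OF x])
    moreover have "x \<in> ?W"
    proof -
      have "?h x = ?r (- s / e + s / e) x" by (rule scale_left_distrib[symmetric])
      also have "- s / e + s / e = 0" by simp
      finally have "?h x = 0" by (simp only: scale_zero_left)
      then show ?thesis using x V(2) by simp
    qed
    moreover have "s * l y < a" if y: "y \<in> ?W" for y
    proof -
      have yT: "y \<in> topspace T" and hy: "?h y \<in> V" using y by simp_all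
      have "l (?h y) = (- s / e) * l x + (s / e) * l y"
        using x yT by (subst ladd) (simp_all only: lscale carrier_closed)
      then have "(- s / e) * l x + (s / e) * l y \<le> 1" using V(3)[OF hy] by simp
      then have "s * l y \<le> s * l x + e" using e by (simp add: field_simps)
      then show ?thesis using b(2) by (simp add: e_def)
    qed
    ultimately show "\<exists>W. openin T W \<and> x \<in> W \<and> W \<subseteq> {x \<in> topspace T. s * l x < a}"
      by (intro exI[of _ ?W]) auto
  qed
  from this[of 1] this[of "- 1" "- a" for a] show ?thesis
    unfolding continuous_map_upper_lower_semicontinuous_lt by simp
qed

text \<open>
  A real-linear functional \<open>l\<close> is the real part of \<open>\<lambda>x. l x - \<i> l (\<i> x)\<close>, which is linear over
  the scalar field. Over the reals \<open>im_unit\<close> is \<open>0\<close> and the formula returns \<open>l\<close> itself.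
\<close>

lemma dual_space_from_real_linear_functional:
  fixes smul :: "'k::real_or_complex \<Rightarrow> 'a::ab_group_add \<Rightarrow> 'a"
  assumes T: "topological_vector_space smul T"
    and l: "real_subspace.linear_functional (\<lambda>r. smul (of_real r)) (topspace T) l"
    and cont: "continuous_map T euclideanreal l"
  shows "(\<lambda>x. if x \<in> topspace T then of_real (l x) - im_unit * of_real (l (smul im_unit x)) else 0)
    \<in> dual_space smul T"
    (is "?f \<in> _")
proof -
  let ?X = "topspace T" and ?i = "im_unit :: 'k"
  interpret vector_space smul by (rule tvs_vector_space[OF T])
  interpret r: real_subspace "\<lambda>r. smul (of_real r)" ?X by (rule real_subspace_tvs[OF T])
  note X = tvs_subspace[OF T]
  have ladd: "l (x + y) = l x + l y" if "x \<in> ?X" "y \<in> ?X" for x y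
    using l that by (simp add: r.linear_functional_def)
  have lscale: "l (smul (of_real c) x) = c * l x" if "x \<in> ?X" for c x
    using l that by (simp add: r.linear_functional_def)
  have closed: "smul c x \<in> ?X" if "x \<in> ?X" for c x using subspace_scale[OF X that] .
  have add: "?f (x + y) = ?f x + ?f y" if "x \<in> ?X" "y \<in> ?X" for x y
    using that closed by (simp add: scale_right_distrib ladd algebra_simps)
  have scale: "?f (smul c x) = c * ?f x" if x: "x \<in> ?X" for c x
  proof -
    define a b where "a = re_part c" and "b = im_part c"
    have c: "c = of_real a + ?i * of_real b" unfolding a_def b_def by (rule scalar_decomp)
    define u v where "u = l x" and "v = l (smul ?i x)"
    have split: "l (smul c y) = a * l y + b * l (smul ?i y)" if "y \<in> ?X" for y
    proof -
      have "smul c y = smul (of_real a) y + smul (of_real b) (smul ?i y)"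
        unfolding c by (simp add: scale_left_distrib mult.commute)
      then show ?thesis using that by (simp only: ladd lscale closed)
    qed
    have "smul ?i (smul c x) = smul c (smul ?i x)" by (simp add: mult.commute)
    then have 1: "l (smul ?i (smul c x)) = a * v + b * l (smul (?i * ?i) x)"
      using split[OF closed[OF x], of ?i] by (simp only: v_def scale_scale)
    have fx: "?f x = of_real u - ?i * of_real v" using x by (simp add: u_def v_def)
    have fcx: "?f (smul c x) = of_real (a * u + b * v) - ?i * of_real (a * v + b * l (smul (?i * ?i) x))"
      using x closed[OF x] split[OF x] 1 by (simp add: u_def v_def)
    show ?thesis
    proof (cases "?i = 0")
      case True
      have "l (smul (of_real 0) x) = 0 * l x" by (rule lscale[OF x])
      then show ?thesis unfolding fx fcx by (simp add: c v_def True)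
    next
      case False
      then have i: "?i * ?i = - 1" using im_unit_cases by blast
      have "l (smul (of_real (- 1)) x) = - 1 * l x" by (rule lscale[OF x])
      then have 2: "l (smul (?i * ?i) x) = - u" by (simp add: i u_def)
      have "c * ?f x = of_real a * of_real u - (?i * ?i) * (of_real b * of_real v)
          - ?i * (of_real a * of_real v - of_real b * of_real u)"
        unfolding fx c by (simp add: algebra_simps)
      also have "\<dots> = ?f (smul c x)" unfolding fcx 2 by (simp add: i algebra_simps)
      finally show ?thesis by simp
    qed
  qed
  have "continuous_map T euclideanreal (\<lambda>x. l (smul ?i x))"
    using continuous_map_compose[OF continuous_map_tvs_scale[OF T _ continuous_map_id, of "\<lambda>_. ?i"] cont]
    by (simp add: o_def)
  then have p: "continuous_map T (prod_topology euclidean euclidean) (\<lambda>x. (l x, l (smul ?i x)))"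
    by (intro continuous_map_pairedI cont)
  have q: "continuous_map (prod_topology euclidean euclidean) euclidean
      (\<lambda>(s, t). of_real s - ?i * of_real t)"
    unfolding prod_topology_euclidean case_prod_unfold continuous_map_iff_continuous2
    by (intro continuous_intros)
  have "continuous_map T euclidean ?f"
    by (rule continuous_map_eq[OF continuous_map_compose[OF p q]]) simp
  then show ?thesis
    unfolding dual_space_def using add scale by auto
qed

text \<open>
  Closedness of \<open>M\<close> and local convexity provide a convex null neighbourhood \<open>C\<close> such that
  \<open>x0 - C\<close> misses \<open>M\<close>; this is what the algebraic separation theorem needs, and the bound on \<open>C\<close>
  makes the functional continuous.
\<close>

theorem dual_space_separates_closed_subspace:
  fixes smul :: "'k::real_or_complex \<Rightarrow> 'a::ab_group_add \<Rightarrow> 'a"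
  assumes lc: "locally_convex_space smul T"
    and M: "closedin T M" "module.subspace smul M"
    and x0: "x0 \<in> topspace T" "x0 \<notin> M"
  obtains f where "f \<in> dual_space smul T" "\<And>x. x \<in> M \<Longrightarrow> f x = 0" "f x0 \<noteq> 0"
proof -
  have T: "topological_vector_space smul T" using lc by (simp add: locally_convex_space_def)
  let ?X = "topspace T"
  let ?r = "\<lambda>r. smul (of_real r)"
  interpret vector_space smul by (rule tvs_vector_space[OF T])
  interpret r: real_subspace ?r ?X by (rule real_subspace_tvs[OF T])
  note V = tvs_vector_space[OF T]
  let ?N = "{y \<in> ?X. x0 + smul (- 1) y \<in> ?X - M}"
  have "openin T ?N"
    by (rule openin_continuous_map_preimage[OF continuous_map_affine[OF T x0(1)]])
      (use M(1) in blast)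
  then have "null_nbhd T ?N"
    unfolding null_nbhd_def using x0 by (intro conjI exI[of _ ?N]) auto
  then obtain C where C: "null_nbhd T C" "convex_wrt smul C" "C \<subseteq> ?N"
    using lc unfolding locally_convex_space_def by blast
  obtain O0 where O0: "openin T O0" "0 \<in> O0" "O0 \<subseteq> C" using C(1) by (auto simp: null_nbhd_def)
  have absorbing: "\<exists>t>0. ?r t x \<in> C" if x: "x \<in> ?X" for x
  proof -
    have "continuous_map euclideanreal T (\<lambda>t. ?r t x)"
      using x by (intro continuous_map_tvs_scale[OF T]) (auto intro!: continuous_intros)
    from openin_continuous_map_preimage[OF this O0(1)] have "open {t. ?r t x \<in> O0}" by simp
    moreover have "0 \<in> {t. ?r t x \<in> O0}" using O0(2) by simp
    ultimately obtain e where e: "e > 0" "ball 0 e \<subseteq> {t. ?r t x \<in> O0}" using openE by blast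
    then have "e / 2 \<in> ball 0 e" by simp
    then have "?r (e / 2) x \<in> C" using e(2) O0(3) by blast
    then show ?thesis using e(1) using half_gt_zero by blast
  qed
  have MX: "M \<subseteq> ?X" using M(1) closedin_subset by blast
  obtain l where l: "r.linear_functional l" "\<And>x. x \<in> M \<Longrightarrow> l x = 0" "\<And>x. x \<in> C \<Longrightarrow> l x \<le> 1"
      "l x0 > 0"
  proof (rule r.linear_functional_separating[of M C x0])
    show "module.subspace ?r M" by (rule subspace_real_scale[OF V M(2)])
    show "?r u x + ?r v y \<in> C" if "x \<in> C" "y \<in> C" "0 \<le> u" "0 \<le> v" "u + v = 1" for x y u v
      using C(2) that unfolding convex_wrt_def by blast
    show "x0 - c \<notin> M" if "c \<in> C" for c using that C(3) by auto
  qed (use MX C(1) O0 absorbing x0(1) in \<open>auto simp: null_nbhd_def\<close>)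
  have "continuous_map T euclideanreal l"
    using O0 l(3) by (intro continuous_map_linear_functional[OF T l(1), of O0]) auto
  from dual_space_from_real_linear_functional[OF T l(1) this] show thesis
  proof (rule that)
    fix x assume x: "x \<in> M"
    then have "smul im_unit x \<in> M" by (rule subspace_scale[OF M(2)])
    then show "(if x \<in> ?X then of_real (l x) - im_unit * of_real (l (smul im_unit x)) else 0) = (0 :: 'k)"
      using l(2) x by simp
  next
    show "(if x0 \<in> ?X then of_real (l x0) - im_unit * of_real (l (smul im_unit x0)) else 0) \<noteq> (0 :: 'k)"
      using x0(1) l(4) of_real_eq_im_unit_mult_of_realD[of "l x0" "l (smul im_unit x0)", where 'k = 'k]
      by auto
  qed
qed

section \<open>Null neighbourhoods of the weak topology\<close>

text \<open>
  Every open set of the weak topology that contains \<open>0\<close> restricts only finitely many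
  evaluations, so it contains all functionals vanishing at those points.
\<close>

lemma weak_star_null_nbhd_contains_annihilator:
  assumes "null_nbhd (weak_star smul T) V"
  shows "\<exists>F. finite F \<and> F \<subseteq> topspace T \<and> {f \<in> dual_space smul T. \<forall>x\<in>F. f x = 0} \<subseteq> V"
proof -
  let ?B = "{{f \<in> dual_space smul T. f x \<in> W} | x W. x \<in> topspace T \<and> open W}"
  obtain W where W: "openin (weak_star smul T) W" "0 \<in> W" "W \<subseteq> V"
    using assms by (auto simp: null_nbhd_def)
  have "generate_topology_on ?B W"
    using W(1) unfolding weak_star_def by (rule openin_topology_generated_by)
  then have "0 \<in> W \<longrightarrow> (\<exists>F. finite F \<and> F \<subseteq> topspace T \<and>
      {f \<in> dual_space smul T. \<forall>x\<in>F. f x = 0} \<subseteq> W)"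
  proof induction
    case (Int U V)
    show ?case
    proof
      assume "0 \<in> U \<inter> V"
      then obtain F G where "finite F" "F \<subseteq> topspace T" "finite G" "G \<subseteq> topspace T"
        "{f \<in> dual_space smul T. \<forall>x\<in>F. f x = 0} \<subseteq> U"
        "{f \<in> dual_space smul T. \<forall>x\<in>G. f x = 0} \<subseteq> V"
        using Int.IH by (meson IntE)
      then show "\<exists>F. finite F \<and> F \<subseteq> topspace T \<and>
          {f \<in> dual_space smul T. \<forall>x\<in>F. f x = 0} \<subseteq> U \<inter> V"
        by (intro exI[of _ "F \<union> G"]) auto
    qed
  next
    case (UN K)
    then show ?case by (meson UnionE Union_upper order_trans)
  next
    case (Basis U)
    then obtain x O0 where x: "x \<in> topspace T" and U: "U = {f \<in> dual_space smul T. f x \<in> O0}"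
      by blast
    show ?case
    proof
      assume "0 \<in> U"
      then have "0 \<in> O0" by (simp add: U)
      then show "\<exists>F. finite F \<and> F \<subseteq> topspace T \<and>
          {f \<in> dual_space smul T. \<forall>x\<in>F. f x = 0} \<subseteq> U"
        using x by (intro exI[of _ "{x}"]) (auto simp: U)
    qed
  qed simp
  then obtain F where "finite F" "F \<subseteq> topspace T"
    "{f \<in> dual_space smul T. \<forall>x\<in>F. f x = 0} \<subseteq> W"
    using W(2) by meson
  then show ?thesis using W(3) by (meson order_trans)
qed

corollary countable_weak_star_null_nbhds:
  assumes "countable \<V>" and "\<And>V. V \<in> \<V> \<Longrightarrow> null_nbhd (weak_star smul T) V"
  obtains D where "countable D" "D \<subseteq> topspace T"
    "{f \<in> dual_space smul T. \<forall>x\<in>D. f x = 0} \<subseteq> \<Inter>\<V>"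
proof -
  have "\<forall>V\<in>\<V>. \<exists>F. finite F \<and> F \<subseteq> topspace T \<and>
      {f \<in> dual_space smul T. \<forall>x\<in>F. f x = 0} \<subseteq> V"
    by (intro ballI weak_star_null_nbhd_contains_annihilator assms(2))
  from bchoice[OF this] obtain F where F: "\<forall>V\<in>\<V>. finite (F V) \<and> F V \<subseteq> topspace T \<and>
      {f \<in> dual_space smul T. \<forall>x\<in>F V. f x = 0} \<subseteq> V" ..
  show thesis
  proof (rule that[of "\<Union>V\<in>\<V>. F V"])
    show "countable (\<Union>V\<in>\<V>. F V)" using assms(1) F by (simp add: countable_finite)
    show "(\<Union>V\<in>\<V>. F V) \<subseteq> topspace T" using F by (simp add: UN_least)
    show "{f \<in> dual_space smul T. \<forall>x\<in>\<Union>V\<in>\<V>. F V. f x = 0} \<subseteq> \<Inter>\<V>"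
    proof (rule Inter_greatest)
      fix V assume V: "V \<in> \<V>"
      then have "{f \<in> dual_space smul T. \<forall>x\<in>\<Union>V\<in>\<V>. F V. f x = 0}
          \<subseteq> {f \<in> dual_space smul T. \<forall>x\<in>F V. f x = 0}"
        by blast
      also have "\<dots> \<subseteq> V" using F V by blast
      finally show "{f \<in> dual_space smul T. \<forall>x\<in>\<Union>V\<in>\<V>. F V. f x = 0} \<subseteq> V" .
    qed
  qed
qed

section \<open>Countable total sets and separability\<close>

text \<open>
  In a locally convex space this means that the linear span is dense; the formulation by
  functionals is the one that conditions on the dual lead to.
\<close>

definition total_set ::
    "('k::real_or_complex \<Rightarrow> 'a::ab_group_add \<Rightarrow> 'a) \<Rightarrow> 'a topology \<Rightarrow> 'a set \<Rightarrow> bool"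
  where "total_set smul T D \<longleftrightarrow>
    D \<subseteq> topspace T \<and> (\<forall>f\<in>dual_space smul T. (\<forall>x\<in>D. f x = 0) \<longrightarrow> f = 0)"

lemma separable_imp_total_sequence:
  assumes T: "topological_vector_space smul T" and sep: "separable_space T"
  obtains x :: "nat \<Rightarrow> _" where "total_set smul T (range x)"
proof -
  obtain D where D: "countable D" "D \<subseteq> topspace T" "T closure_of D = topspace T"
    using sep by (auto simp: separable_space_def)
  interpret vector_space smul by (rule tvs_vector_space[OF T])
  have "0 \<in> topspace T" using subspace_0[OF tvs_subspace[OF T]] .
  then have "D \<noteq> {}" using D(3) by auto
  then have range: "range (from_nat_into D) = D" using D(1) by (rule range_from_nat_into)
  have "f = 0" if f: "f \<in> dual_space smul T" and D0: "\<forall>x\<in>D. f x = 0" for f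
  proof
    fix y
    have "continuous_map T euclidean f" using f by (simp add: dual_space_def)
    from closedin_continuous_map_preimage[OF this, of "{0}"]
    have "closedin T {x \<in> topspace T. f x \<in> {0}}" by simp
    then have "T closure_of D \<subseteq> {x \<in> topspace T. f x \<in> {0}}"
      using D(2) D0 by (intro closure_of_minimal) auto
    then show "f y = 0 y"
      using D(3) f by (cases "y \<in> topspace T") (auto simp: dual_space_def)
  qed
  then have "total_set smul T (range (from_nat_into D))"
    unfolding total_set_def range using D(2) by blast
  then show thesis by (rule that)
qed

text \<open>
  The combinations of members of \<open>D\<close> with coefficients in a countable dense subring form a
  countable set, whose closure is a linear subspace.
\<close>

lemma separable_if_countable_total_set:
  fixes smul :: "'k::real_or_complex \<Rightarrow> 'a::ab_group_add \<Rightarrow> 'a"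
  assumes lc: "locally_convex_space smul T"
    and D: "countable D" "total_set smul T D"
  shows "separable_space T"
proof -
  have T: "topological_vector_space smul T" using lc by (simp add: locally_convex_space_def)
  let ?X = "topspace T" and ?Q = "rational_scalars :: 'k set"
  interpret vector_space smul by (rule tvs_vector_space[OF T])
  note X = tvs_subspace[OF T]
  have DX: "D \<subseteq> ?X" using D(2) by (simp add: total_set_def)
  define comb where "comb l = sum_list (map (\<lambda>(q, d). smul q d) l)" for l :: "('k \<times> 'a) list"
  define E where "E = comb ` lists (?Q \<times> D)"
  define M where "M = T closure_of E"
  have "countable E"
    unfolding E_def
    by (intro countable_image countable_lists countable_SIGMA countable_rational_scalars D(1))
  have comb_X: "comb l \<in> ?X" if "l \<in> lists (?Q \<times> D)" for l
    using that
  proof (induction l)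
    case (Cons a l)
    then have "smul (fst a) (snd a) \<in> ?X" using DX subspace_scale[OF X] by auto
    then have "smul (fst a) (snd a) + comb l \<in> ?X" using Cons subspace_add[OF X] by blast
    then show ?case by (simp add: comb_def case_prod_unfold)
  qed (simp add: comb_def subspace_0[OF X])
  have EX: "E \<subseteq> ?X" unfolding E_def using comb_X by blast
  have EM: "E \<subseteq> M" unfolding M_def using EX by (rule closure_of_subset)
  have MX: "M \<subseteq> ?X" unfolding M_def by (rule closure_of_subset_topspace)
  have E0: "0 \<in> E" unfolding E_def by (rule image_eqI[of _ _ "[]"]) (simp_all add: comb_def)
  have E_add: "x + y \<in> E" if xy: "x \<in> E" "y \<in> E" for x y
  proof -
    obtain l k where "l \<in> lists (?Q \<times> D)" "x = comb l" "k \<in> lists (?Q \<times> D)" "y = comb k"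
      using xy unfolding E_def by blast
    then show ?thesis unfolding E_def by (intro image_eqI[of _ _ "l @ k"]) (auto simp: comb_def)
  qed
  have E_scale: "smul q x \<in> E" if q: "q \<in> ?Q" and x: "x \<in> E" for q x
  proof -
    obtain l where l: "l \<in> lists (?Q \<times> D)" "x = comb l" using x unfolding E_def by blast
    let ?l = "map (\<lambda>(p, d). (q * p, d)) l"
    have "smul q (comb l) = comb ?l"
      by (induction l) (auto simp: comb_def scale_right_distrib)
    moreover have "?l \<in> lists (?Q \<times> D)"
      using l(1) q rational_scalars_mult by (induction l) auto
    ultimately show ?thesis unfolding E_def l(2) by (intro image_eqI[of _ _ ?l])
  qed
  have DE: "D \<subseteq> E"
  proof
    fix d assume "d \<in> D"
    then show "d \<in> E"
      unfolding E_def
      by (intro image_eqI[of _ _ "[(1, d)]"]) (auto simp: comb_def one_rational_scalars)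
  qed
  have M_add: "x + y \<in> M" if "x \<in> M" "y \<in> M" for x y
  proof -
    have "(x, y) \<in> prod_topology T T closure_of (E \<times> E)"
      using that by (simp add: closure_of_Times M_def)
    then have "x + y \<in> T closure_of ((\<lambda>(x, y). x + y) ` (E \<times> E))"
      using continuous_map_image_closure_subset[OF tvs_add[OF T]] by force
    moreover have "(\<lambda>(x, y). x + y) ` (E \<times> E) \<subseteq> E" using E_add by auto
    ultimately show ?thesis unfolding M_def using closure_of_mono by blast
  qed
  have M_scale: "smul c x \<in> M" if "x \<in> M" for c x
  proof -
    have "(c, x) \<in> prod_topology euclidean T closure_of (?Q \<times> E)"
      using that by (simp add: closure_of_Times M_def closure_rational_scalars)
    then have "smul c x \<in> T closure_of ((\<lambda>(c, x). smul c x) ` (?Q \<times> E))"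
      using continuous_map_image_closure_subset[OF tvs_scale[OF T]] by force
    moreover have "(\<lambda>(c, x). smul c x) ` (?Q \<times> E) \<subseteq> E" using E_scale by auto
    ultimately show ?thesis unfolding M_def using closure_of_mono by blast
  qed
  have "subspace M" unfolding subspace_def using M_add M_scale EM E0 by blast
  have "M = ?X"
  proof (rule ccontr)
    assume "M \<noteq> ?X"
    then obtain x0 where x0: "x0 \<in> ?X" "x0 \<notin> M" using MX by blast
    obtain f where f: "f \<in> dual_space smul T" "\<And>x. x \<in> M \<Longrightarrow> f x = 0" "f x0 \<noteq> 0"
      using dual_space_separates_closed_subspace[OF lc _ \<open>subspace M\<close> x0]
      unfolding M_def by auto
    then have "f = 0" using D(2) DE EM unfolding total_set_def by blast
    then show False using f(3) by simp
  qed
  then show ?thesis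
    unfolding separable_space_def using \<open>countable E\<close> EX M_def by blast
qed

section \<open>Total sets from conditions on the dual\<close>

text \<open>
  The polar always contains the zero functional, so the supremum is not over the empty set, where
  it would be \<open>- \<infinity>\<close>.
\<close>

lemma support_function_polar_eq_0:
  fixes smul :: "'k::real_or_complex \<Rightarrow> 'a::ab_group_add \<Rightarrow> 'a"
  assumes "\<And>g. g \<in> polar smul T A \<Longrightarrow> g y = 0"
  shows "support_function (polar smul T A) y = 0"
proof -
  have "0 \<in> polar smul T A" by (simp add: polar_def dual_space_def zero_fun_def)
  then have ne: "polar smul T A \<noteq> {}" by blast
  have "support_function (polar smul T A) y = (SUP g\<in>polar smul T A. 0)"
    unfolding support_function_def by (rule SUP_cong) (simp_all add: assms)
  also have "\<dots> = 0" using ne by simp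
  finally show ?thesis .
qed

text \<open>
  A functional \<open>f\<close> that vanishes on \<open>D\<close> lies in every \<open>U n\<close> with all its scalar multiples. An
  element of the polar is bounded on this line, hence vanishes at \<open>f\<close>, and separation gives
  \<open>f = 0\<close>.
\<close>

lemma countable_total_set_if_countably_separated:
  fixes smul :: "'k::real_or_complex \<Rightarrow> 'a::ab_group_add \<Rightarrow> 'a"
  assumes T: "topological_vector_space smul T"
    and cs: "countably_separated fun_scale (weak_star smul T)"
  obtains D where "countable D" "total_set smul T D"
proof -
  let ?w = "weak_star smul T" and ?X' = "dual_space smul T"
  interpret v: vector_space "fun_scale :: 'k \<Rightarrow> ('a \<Rightarrow> 'k) \<Rightarrow> _" by (rule vector_space_fun_scale)
  obtain U :: "nat \<Rightarrow> ('a \<Rightarrow> 'k) set" where U: "\<And>n. null_nbhd ?w (U n)"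
    and sep: "(\<Inter>n. {y \<in> topspace ?w. support_function (polar fun_scale ?w (U n)) y = 0}) = {0}"
    using cs unfolding countably_separated_def by blast
  obtain D where D: "countable D" "D \<subseteq> topspace T"
    "{f \<in> ?X'. \<forall>x\<in>D. f x = 0} \<subseteq> \<Inter>(range U)"
    by (rule countable_weak_star_null_nbhds[of "range U" smul T]) (use U in auto)
  have "f = 0" if f: "f \<in> ?X'" and f0: "\<forall>x\<in>D. f x = 0" for f
  proof -
    have "support_function (polar fun_scale ?w (U n)) f = 0" for n
    proof -
      have cf: "fun_scale c f \<in> U n" for c
      proof -
        have "fun_scale c f \<in> {f \<in> ?X'. \<forall>x\<in>D. f x = 0}"
          using v.subspace_scale[OF subspace_dual_space[OF T] f] f0 by (simp add: fun_scale_def)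
        then show ?thesis using D(3) by blast
      qed
      have g0: "g f = 0" if g: "g \<in> polar fun_scale ?w (U n)" for g
      proof (rule scalar_eq_0_if_re_part_bounded)
        fix c
        have "g (fun_scale c f) = c * g f"
          using g f by (simp add: polar_def dual_space_def[of fun_scale] topspace_weak_star[OF T])
        then show "re_part (c * g f) \<le> 1" using g cf[of c] by (auto simp: polar_def)
      qed
      then show ?thesis by (rule support_function_polar_eq_0)
    qed
    then have "f \<in> (\<Inter>n. {y \<in> topspace ?w. support_function (polar fun_scale ?w (U n)) y = 0})"
      using f by (simp add: topspace_weak_star[OF T])
    then show ?thesis unfolding sep by simp
  qed
  then have "total_set smul T D" using D(2) by (simp add: total_set_def)
  then show thesis using that D(1) by blast
qed

text \<open>
  A metrizable topology has a countable neighbourhood base at \<open>0\<close>, and the intersection of this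
  base is \<open>{0}\<close> because points are closed.
\<close>

lemma countable_total_set_if_coarser_metrizable:
  fixes smul :: "'k::real_or_complex \<Rightarrow> 'a::ab_group_add \<Rightarrow> 'a"
  assumes T: "topological_vector_space smul T"
    and S: "metrizable_space S" "coarser_topology S (weak_star smul T)"
  obtains D where "countable D" "total_set smul T D"
proof -
  let ?w = "weak_star smul T" and ?X' = "dual_space smul T"
  interpret v: vector_space "fun_scale :: 'k \<Rightarrow> ('a \<Rightarrow> 'k) \<Rightarrow> _" by (rule vector_space_fun_scale)
  have S_top: "topspace S = ?X'" and S_open: "\<And>U. openin S U \<Longrightarrow> openin ?w U"
    using S(2) topspace_weak_star[OF T] by (auto simp: coarser_topology_def)
  have z: "0 \<in> topspace S" using v.subspace_0[OF subspace_dual_space[OF T]] S_top by simp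
  have "\<exists>\<B>. countable \<B> \<and> (\<forall>V\<in>\<B>. openin S V) \<and>
      (\<forall>U. openin S U \<and> 0 \<in> U \<longrightarrow> (\<exists>V\<in>\<B>. 0 \<in> V \<and> V \<subseteq> U))"
    using metrizable_imp_first_countable[OF S(1)] z unfolding first_countable_def by (rule bspec)
  then obtain \<B> where B: "countable \<B>" "\<And>V. V \<in> \<B> \<Longrightarrow> openin S V"
    "\<And>U. openin S U \<Longrightarrow> 0 \<in> U \<Longrightarrow> \<exists>V\<in>\<B>. 0 \<in> V \<and> V \<subseteq> U"
    by meson
  let ?V = "{V \<in> \<B>. 0 \<in> V}"
  have cnt: "countable ?V" using B(1) by (rule countable_Collect)
  have nbhd: "null_nbhd ?w V" if V: "V \<in> ?V" for V
  proof -
    have "openin ?w V" using V by (intro S_open B(2)) simp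
    then show ?thesis unfolding null_nbhd_def using V openin_subset by auto
  qed
  obtain D where D: "countable D" "D \<subseteq> topspace T"
    "{f \<in> ?X'. \<forall>x\<in>D. f x = 0} \<subseteq> \<Inter>?V"
    by (rule countable_weak_star_null_nbhds[OF cnt nbhd])
  have "f = 0" if f: "f \<in> ?X'" and f0: "\<forall>x\<in>D. f x = 0" for f
  proof (rule ccontr)
    assume "f \<noteq> 0"
    have "closedin S {f}"
      using closedin_Hausdorff_singleton[OF metrizable_imp_Hausdorff_space[OF S(1)]] f S_top by simp
    then have "openin S (topspace S - {f})" by blast
    moreover have "0 \<in> topspace S - {f}" using z \<open>f \<noteq> 0\<close> by blast
    ultimately obtain V where "V \<in> \<B>" "0 \<in> V" "V \<subseteq> topspace S - {f}" using B(3) by meson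
    moreover then have "f \<in> V" using D(3) f f0 by blast
    ultimately show False by blast
  qed
  then have "total_set smul T D" using D(2) by (simp add: total_set_def)
  then show thesis using that D(1) by blast
qed

section \<open>Structure on the dual from a total sequence\<close>

text \<open>
  The polar of \<open>U n = {f. \<bar>f (x n)\<bar> \<le> 1}\<close> contains the evaluation at \<open>x n\<close> multiplied by any scalar
  of norm at most \<open>1\<close>. A vanishing support function at \<open>f\<close> therefore forces \<open>f (x n) = 0\<close>.
\<close>

lemma countably_separated_if_total_sequence:
  fixes smul :: "'k::real_or_complex \<Rightarrow> 'a::ab_group_add \<Rightarrow> 'a"
  assumes T: "topological_vector_space smul T"
    and x: "total_set smul T (range (x :: nat \<Rightarrow> 'a))"
  shows "countably_separated fun_scale (weak_star smul T)"
proof -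
  let ?w = "weak_star smul T" and ?X' = "dual_space smul T"
  define U where "U n = {f \<in> ?X'. norm (f (x n)) \<le> 1}" for n
  interpret v: vector_space "fun_scale :: 'k \<Rightarrow> ('a \<Rightarrow> 'k) \<Rightarrow> _" by (rule vector_space_fun_scale)
  note X' = subspace_dual_space[OF T]
  have xX: "x n \<in> topspace T" for n using x by (auto simp: total_set_def)
  note ev = continuous_map_weak_star_eval[OF T xX]
  note tw = topspace_weak_star[OF T]
  have "absolutely_convex fun_scale (U n)" for n
    unfolding absolutely_convex_def
  proof (intro ballI allI impI)
    fix f g and a b :: 'k assume fg: "f \<in> U n" "g \<in> U n" and ab: "norm a + norm b \<le> 1"
    have "norm (a * f (x n) + b * g (x n)) \<le> norm a * norm (f (x n)) + norm b * norm (g (x n))"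
      by (metis norm_mult norm_triangle_ineq)
    also have "\<dots> \<le> norm a * 1 + norm b * 1"
      using fg by (intro add_mono mult_left_mono) (auto simp: U_def)
    finally have "norm (a * f (x n) + b * g (x n)) \<le> 1" using ab by simp
    moreover have "fun_scale a f + fun_scale b g \<in> ?X'"
      using fg by (intro v.subspace_add[OF X'] v.subspace_scale[OF X']) (auto simp: U_def)
    ultimately show "fun_scale a f + fun_scale b g \<in> U n" by (simp add: U_def fun_scale_def)
  qed
  moreover have "closedin ?w (U n)" for n
    using closedin_continuous_map_preimage[OF ev, of "cball 0 1" n] by (simp add: U_def tw)
  moreover have "null_nbhd ?w (U n)" for n
    unfolding null_nbhd_def
  proof (intro conjI exI)
    show "openin ?w {f \<in> ?X'. f (x n) \<in> ball 0 1}"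
      using openin_continuous_map_preimage[OF ev, of "ball 0 1" n] by (simp add: tw)
  qed (use v.subspace_0[OF X'] in \<open>auto simp: U_def tw\<close>)
  moreover have "(\<Inter>n. {f \<in> topspace ?w. support_function (polar fun_scale ?w (U n)) f = 0}) = {0}"
    (is "?I = {0}")
  proof (intro equalityI subsetI)
    fix f assume "f \<in> ?I"
    then have f: "f \<in> ?X'" and sup: "\<And>n. support_function (polar fun_scale ?w (U n)) f = 0"
      by (auto simp: tw)
    have "f (x n) = 0" for n
    proof (rule scalar_eq_0_if_re_part_nonpos)
      fix c :: 'k assume c: "norm c \<le> 1"
      \<comment> \<open>Members of the dual must vanish outside the carrier.\<close>
      define g where "g h = (if h \<in> ?X' then c * h (x n) else 0)" for h
      have "continuous_map ?w euclidean (\<lambda>h. c * h (x n))"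
        using continuous_map_compose[OF ev, of euclidean "\<lambda>z. c * z" n]
        by (simp add: o_def continuous_on_mult_left)
      then have "continuous_map ?w euclidean g"
        by (rule continuous_map_eq) (simp add: g_def tw)
      then have "g \<in> dual_space fun_scale ?w"
        unfolding dual_space_def[of fun_scale] tw
        using v.subspace_add[OF X'] v.subspace_scale[OF X']
        by (auto simp: g_def fun_scale_def algebra_simps)
      moreover have "re_part (g h) \<le> 1" if "h \<in> U n" for h
      proof -
        have "re_part (g h) \<le> norm c * norm (h (x n))"
          using re_part_le_norm[of "g h"] that by (simp add: g_def U_def norm_mult)
        also have "\<dots> \<le> 1 * 1" using c that by (intro mult_mono) (auto simp: U_def)
        finally show ?thesis by simp
      qed
      ultimately have "g \<in> polar fun_scale ?w (U n)" by (simp add: polar_def)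
      then have "ereal (re_part (g f)) \<le> support_function (polar fun_scale ?w (U n)) f"
        unfolding support_function_def by (rule SUP_upper)
      then show "re_part (c * f (x n)) \<le> 0" using sup f by (simp add: g_def)
    qed
    then show "f \<in> {0}" using x f by (auto simp: total_set_def)
  next
    fix f :: "'a \<Rightarrow> 'k" assume "f \<in> {0}"
    then have f: "f = 0" by simp
    have z: "0 \<in> ?X'" by (rule v.subspace_0[OF X'])
    have g0: "g 0 = 0" if "g \<in> dual_space fun_scale ?w" for g :: "('a \<Rightarrow> 'k) \<Rightarrow> 'k"
    proof -
      have "g (0 + 0) = g 0 + g 0" using that z unfolding dual_space_def[of fun_scale] tw by blast
      then show ?thesis by simp
    qed
    have "support_function (polar fun_scale ?w (U n)) 0 = 0" for n
      using g0 by (intro support_function_polar_eq_0) (simp add: polar_def)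
    then show "f \<in> ?I" using z by (simp add: f tw)
  qed
  ultimately show ?thesis unfolding countably_separated_def by blast
qed

text \<open>
  The topology of pointwise convergence at the members of a sequence. As a pullback of the product
  topology it inherits metrizability along an injective coordinate map.
\<close>

definition sequence_topology ::
    "('k::real_or_complex \<Rightarrow> 'a::ab_group_add \<Rightarrow> 'a) \<Rightarrow> 'a topology \<Rightarrow> (nat \<Rightarrow> 'a) \<Rightarrow> ('a \<Rightarrow> 'k) topology"
  where "sequence_topology smul T x =
    pullback_topology (dual_space smul T) (\<lambda>f n. f (x n)) euclidean"

lemma topspace_sequence_topology [simp]:
  "topspace (sequence_topology smul T x) = dual_space smul T"
  by (simp add: sequence_topology_def topspace_pullback_topology)

lemma continuous_map_sequence_topology_coordinates:
  "continuous_map (sequence_topology smul T x) euclidean (\<lambda>f n. f (x n))"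
  using continuous_map_pullback[OF continuous_map_id]
  by (simp add: sequence_topology_def o_def)

lemma continuous_map_sequence_topology_eval:
  "continuous_map (sequence_topology smul T x) euclidean (\<lambda>f. f (x n))"
proof -
  have "continuous_map euclidean euclidean (\<lambda>a :: nat \<Rightarrow> _. a n)"
    by (simp add: continuous_on_product_coordinates)
  from continuous_map_compose[OF continuous_map_sequence_topology_coordinates this]
  show ?thesis by (simp add: o_def)
qed

lemma continuous_map_into_sequence_topology:
  assumes "F \<in> topspace Z \<rightarrow> dual_space smul T"
    and "\<And>n. continuous_map Z euclidean (\<lambda>z. F z (x n))"
  shows "continuous_map Z (sequence_topology smul T x) F"
  unfolding sequence_topology_def
proof (rule continuous_map_pullback')
  have "continuous_map Z (product_topology (\<lambda>_. euclidean) UNIV) (\<lambda>z n. F z (x n))"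
    using assms(2) by (simp add: continuous_map_componentwise_UNIV)
  then show "continuous_map Z euclidean ((\<lambda>f n. f (x n)) \<circ> F)"
    by (simp add: euclidean_product_topology o_def)
qed (use assms(1) in auto)

lemma coarser_sequence_topology:
  assumes T: "topological_vector_space smul T" and x: "range x \<subseteq> topspace T"
  shows "coarser_topology (sequence_topology smul T x) (weak_star smul T)"
proof -
  have "continuous_map (weak_star smul T) (sequence_topology smul T x) (\<lambda>f. f)"
    using x by (intro continuous_map_into_sequence_topology continuous_map_weak_star_eval[OF T])
      (auto simp: topspace_weak_star[OF T])
  note preimage = openin_continuous_map_preimage[OF this]
  have "openin (weak_star smul T) U" if U: "openin (sequence_topology smul T x) U" for U
  proof -
    have "{f \<in> topspace (weak_star smul T). f \<in> U} = U"
      using openin_subset[OF U] by (auto simp: topspace_weak_star[OF T])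
    then show ?thesis using preimage[OF U] by simp
  qed
  then show ?thesis by (simp add: coarser_topology_def topspace_weak_star[OF T])
qed

text \<open>
  Totality makes the coordinate map injective, so that it embeds the dual into the metrizable
  space of all scalar sequences.
\<close>

lemma metrizable_sequence_topology:
  fixes smul :: "'k::real_or_complex \<Rightarrow> 'a::ab_group_add \<Rightarrow> 'a"
  assumes T: "topological_vector_space smul T" and x: "total_set smul T (range x)"
  shows "metrizable_space (sequence_topology smul T x)"
proof -
  let ?X' = "dual_space smul T" and ?S = "sequence_topology smul T x"
  define \<Phi> where "\<Phi> = (\<lambda>f n. f (x n) :: 'k)"
  let ?R = "subtopology euclidean (\<Phi> ` ?X')"
  interpret v: vector_space "fun_scale :: 'k \<Rightarrow> ('a \<Rightarrow> 'k) \<Rightarrow> _" by (rule vector_space_fun_scale)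
  have inj: "inj_on \<Phi> ?X'"
  proof (rule inj_onI)
    fix f g assume f: "f \<in> ?X'" "g \<in> ?X'" and eq: "\<Phi> f = \<Phi> g"
    have "f - g \<in> ?X'" using v.subspace_diff[OF subspace_dual_space[OF T] f] .
    moreover have "\<forall>y\<in>range x. (f - g) y = 0" using eq by (auto simp: \<Phi>_def fun_eq_iff)
    ultimately have "f - g = 0" using x unfolding total_set_def by blast
    then show "f = g" by simp
  qed
  have "homeomorphic_map ?S ?R \<Phi>"
  proof (rule bijective_open_imp_homeomorphic_map)
    show "continuous_map ?S ?R \<Phi>"
      using continuous_map_sequence_topology_coordinates[of smul T x]
      by (auto simp: continuous_map_in_subtopology \<Phi>_def)
    show "open_map ?S ?R \<Phi>"
      unfolding open_map_def
    proof (intro allI impI)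
      fix U assume "openin ?S U"
      then obtain W where W: "open W" "U = \<Phi> -` W \<inter> ?X'"
        by (auto simp: sequence_topology_def openin_pullback_topology \<Phi>_def)
      then have "\<Phi> ` U = \<Phi> ` ?X' \<inter> W" by auto
      then show "openin ?R (\<Phi> ` U)" using W(1) by (simp add: openin_open_Int)
    qed
  qed (use inj in simp_all)
  then have "?S homeomorphic_space ?R" by (rule homeomorphic_map_imp_homeomorphic_space)
  moreover have "metrizable_space ?R"
    by (intro metrizable_space_subtopology metrizable_space_euclidean)
  ultimately show ?thesis using homeomorphic_metrizable_space by blast
qed

lemma topological_vector_space_sequence_topology:
  fixes smul :: "'k::real_or_complex \<Rightarrow> 'a::ab_group_add \<Rightarrow> 'a"
  assumes T: "topological_vector_space smul T"
  shows "topological_vector_space fun_scale (sequence_topology smul T x)"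
proof -
  let ?D = "dual_space smul T" and ?S = "sequence_topology smul T x"
  interpret v: vector_space "fun_scale :: 'k \<Rightarrow> ('a \<Rightarrow> 'k) \<Rightarrow> _" by (rule vector_space_fun_scale)
  note D = subspace_dual_space[OF T]
  note ev = continuous_map_sequence_topology_eval[of smul T x]
  have "continuous_map (prod_topology ?S ?S) ?S (\<lambda>(f, g). f + g)"
  proof (rule continuous_map_into_sequence_topology)
    fix n
    have "continuous_map (prod_topology ?S ?S) euclidean (\<lambda>p. fst p (x n) + snd p (x n))"
      using continuous_map_compose[OF continuous_map_fst ev]
        continuous_map_compose[OF continuous_map_snd ev]
      by (auto simp: o_def intro!: continuous_map_add)
    then show "continuous_map (prod_topology ?S ?S) euclidean
        (\<lambda>p. (case p of (f, g) \<Rightarrow> f + g) (x n))"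
      by (simp add: case_prod_unfold)
  qed (use v.subspace_add[OF D] in auto)
  moreover have "continuous_map (prod_topology euclidean ?S) ?S (\<lambda>(c, f). fun_scale c f)"
  proof (rule continuous_map_into_sequence_topology)
    fix n
    have p: "continuous_map (prod_topology euclidean ?S) (prod_topology euclidean euclidean)
        (\<lambda>p. (fst p, snd p (x n)))"
      using continuous_map_compose[OF continuous_map_snd ev, of euclidean]
      by (simp only: continuous_map_paired continuous_map_fst o_def simp_thms)
    have m: "continuous_map (prod_topology euclidean euclidean) euclidean (\<lambda>(c, d). c * d :: 'k)"
      unfolding prod_topology_euclidean case_prod_unfold continuous_map_iff_continuous2
      by (intro continuous_intros)
    show "continuous_map (prod_topology euclidean ?S) euclidean
        (\<lambda>p. (case p of (c, f) \<Rightarrow> fun_scale c f) (x n))"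
      using continuous_map_compose[OF p m] by (simp add: o_def case_prod_unfold fun_scale_def)
  qed (use v.subspace_scale[OF D] in auto)
  ultimately show ?thesis
    unfolding topological_vector_space_def using vector_space_fun_scale D by auto
qed

text \<open>
  A basic open box around \<open>0\<close> restricts finitely many coordinates, and each restricting factor can
  be shrunk to a ball; the resulting box is convex.
\<close>

lemma locally_convex_sequence_topology:
  fixes smul :: "'k::real_or_complex \<Rightarrow> 'a::ab_group_add \<Rightarrow> 'a"
  assumes T: "topological_vector_space smul T"
  shows "locally_convex_space fun_scale (sequence_topology smul T x)"
  unfolding locally_convex_space_def
proof (intro conjI topological_vector_space_sequence_topology[OF T] allI impI)
  let ?D = "dual_space smul T" and ?S = "sequence_topology smul T x"
  interpret v: vector_space "fun_scale :: 'k \<Rightarrow> ('a \<Rightarrow> 'k) \<Rightarrow> _" by (rule vector_space_fun_scale)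
  note D = subspace_dual_space[OF T]
  fix U assume "null_nbhd ?S U"
  then obtain W where W: "openin ?S W" "0 \<in> W" "W \<subseteq> U" by (auto simp: null_nbhd_def)
  then obtain P where P: "open P" "W = (\<lambda>f n. f (x n)) -` P \<inter> ?D"
    by (auto simp: sequence_topology_def openin_pullback_topology)
  have "openin (product_topology (\<lambda>_::nat. euclidean :: 'k topology) UNIV) P"
    using P(1) by (simp add: euclidean_product_topology)
  moreover have "(\<lambda>n. 0) \<in> P" using W(2) P(2) by simp
  ultimately obtain B :: "nat \<Rightarrow> 'k set" where B: "(\<lambda>n. 0) \<in> (\<Pi>\<^sub>E i\<in>UNIV. B i)" "\<And>i. open (B i)"
    "finite {i. B i \<noteq> UNIV}" "(\<Pi>\<^sub>E i\<in>UNIV. B i) \<subseteq> P"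
    using product_topology_open_contains_basis[of "\<lambda>_. euclidean" UNIV P "\<lambda>n. 0"] by auto
  have "\<exists>A. open A \<and> convex A \<and> 0 \<in> A \<and> A \<subseteq> B i \<and> (B i = UNIV \<longrightarrow> A = UNIV)" for i
  proof (cases "B i = UNIV")
    case False
    have "0 \<in> B i" using B(1) by auto
    then obtain e where "e > 0" "ball 0 e \<subseteq> B i" using openE[OF B(2)] by blast
    then show ?thesis using False by (intro exI[of _ "ball 0 e"]) auto
  qed auto
  then obtain A where A: "\<And>i. open (A i)" "\<And>i. convex (A i)" "\<And>i. 0 \<in> A i" "\<And>i. A i \<subseteq> B i"
    "\<And>i. B i = UNIV \<Longrightarrow> A i = UNIV"
    by metis
  let ?C = "{f \<in> ?D. \<forall>i. f (x i) \<in> A i}"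
  have "finite {i. A i \<noteq> UNIV}" by (rule finite_subset[OF _ B(3)]) (use A(5) in auto)
  then have "openin (product_topology (\<lambda>_. euclidean) UNIV) (\<Pi>\<^sub>E i\<in>UNIV. A i)"
    using A(1) by (intro product_topology_basis) auto
  then have "open (\<Pi>\<^sub>E i\<in>UNIV. A i)" by (simp add: euclidean_product_topology)
  moreover have "?C = (\<lambda>f n. f (x n)) -` (\<Pi>\<^sub>E i\<in>UNIV. A i) \<inter> ?D" by auto
  ultimately have "openin ?S ?C"
    unfolding sequence_topology_def openin_pullback_topology by auto
  moreover have "0 \<in> ?C" using A(3) v.subspace_0[OF D] by simp
  ultimately have "null_nbhd ?S ?C" unfolding null_nbhd_def by auto
  moreover have "convex_wrt fun_scale ?C"
    unfolding convex_wrt_def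
  proof (intro ballI allI impI)
    fix f g and u v :: real
    assume fg: "f \<in> ?C" "g \<in> ?C" and uv: "0 \<le> u" "0 \<le> v" "u + v = 1"
    have "u *\<^sub>R f (x i) + v *\<^sub>R g (x i) \<in> A i" for i
      by (rule convexD[OF A(2)]) (use fg uv in simp_all)
    moreover have "fun_scale (of_real u) f + fun_scale (of_real v) g \<in> ?D"
      using fg by (intro v.subspace_add[OF D] v.subspace_scale[OF D]) auto
    ultimately show "fun_scale (of_real u) f + fun_scale (of_real v) g \<in> ?C"
      by (simp add: fun_scale_def scaleR_conv_of_real)
  qed
  moreover have "?C \<subseteq> U"
  proof
    fix f assume f: "f \<in> ?C"
    then have "(\<lambda>n. f (x n)) \<in> (\<Pi>\<^sub>E i\<in>UNIV. B i)" using A(4) by (auto simp: PiE_UNIV_domain)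
    then show "f \<in> U" using f B(4) P(2) W(3) by auto
  qed
  ultimately show "\<exists>C. null_nbhd ?S C \<and> convex_wrt fun_scale C \<and> C \<subseteq> U" by blast
qed

section \<open>Separability in terms of the dual\<close>

theorem theorem3p3:
  fixes smul :: "'k::real_or_complex \<Rightarrow> 'a::ab_group_add \<Rightarrow> 'a"
    and T :: "'a topology"
  assumes "locally_convex_space smul T"
    and "Hausdorff_space T"
  shows "(separable_space T \<longleftrightarrow>
            countably_separated fun_scale (weak_star smul T)) \<and>
         (separable_space T \<longleftrightarrow>
            (\<exists>S. metrizable_space S \<and> coarser_topology S (weak_star smul T))) \<and>
         (separable_space T \<longleftrightarrow>
            (\<exists>S. metrizable_space S \<and> locally_convex_space fun_scale S \<and>
                 coarser_topology S (weak_star smul T)))"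
proof -
  have T: "topological_vector_space smul T" using assms(1) by (simp add: locally_convex_space_def)
  have cs: "countably_separated fun_scale (weak_star smul T)" if sep: "separable_space T"
    using separable_imp_total_sequence[OF T sep] countably_separated_if_total_sequence[OF T] by blast
  have lc: "\<exists>S. metrizable_space S \<and> locally_convex_space fun_scale S \<and>
      coarser_topology S (weak_star smul T)" if sep: "separable_space T"
  proof -
    obtain x :: "nat \<Rightarrow> 'a" where x: "total_set smul T (range x)"
      using separable_imp_total_sequence[OF T sep] by blast
    then have "range x \<subseteq> topspace T" by (simp add: total_set_def)
    then show ?thesis
      using metrizable_sequence_topology[OF T x] locally_convex_sequence_topology[OF T, of x]
        coarser_sequence_topology[OF T, of x] by blast
  qed
  have "separable_space T" if "countably_separated fun_scale (weak_star smul T)"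
    using countable_total_set_if_countably_separated[OF T that]
      separable_if_countable_total_set[OF assms(1)] by blast
  moreover have "separable_space T" if "metrizable_space S" "coarser_topology S (weak_star smul T)" for S
    using countable_total_set_if_coarser_metrizable[OF T that]
      separable_if_countable_total_set[OF assms(1)] by blast
  ultimately show ?thesis using cs lc by blast
qed

end
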